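(* Let $N\ge1$, $M\ge N$, $\sigma>0$. For every GKP-stabilizer code $(\bm S_{\rm enc},\bm M,\bm f)$ there exist gains $G_1,\dots,G_N\ge1$, a matrix $\bm\Lambda_a\in{\rm Sp}(2M,\mathbb R)$ and a measurable estimator $\bm f'$ such that the TMS code $(\bm T_{\bm G},\bm\Lambda_a\bm M,\bm f')$ has the same geometric-mean error $\bar\sigma^2_{\rm GM}$ as $(\bm S_{\rm enc},\bm M,\bm f)$. (Here $\bm\Lambda_a\bm M$ is again a symplectically integral lattice generator.)
   Context: Phase-space vectors in $\mathbb R^{2n}$ are ordered $(q_1,p_1,\dots,q_n,p_n)$; $\bm\Omega$ (of the appropriate size) $=\bigoplus\begin{pmatrix}0&1\\-1&0\end{pmatrix}$; ${\rm Sp}(2n,\mathbb R)=\{\bm S:\bm S\bm\Omega\bm S^\top=\bm\Omega\}$. For $G\ge1$, $\bm S_G=\begin{pmatrix}\sqrt G\bm I_2&\sqrt{G-1}\bm Z\\ \sqrt{G-1}\bm Z&\sqrt G\bm I_2\end{pmatrix}$, $\bm Z={\rm diag}(1,-1)$; $\bm T_{\bm G}\in{\rm Sp}(2K,\mathbb R)$ ($K=N+M$) acts as $\bm S_{G_i}$ on (data mode $i$, ancilla mode $i$), $i\le N$, and as identity on ancilla modes $N+1,\dots,M$. A symplectically integral lattice generator is an invertible $\bm M\in\mathbb R^{2M\times2M}$ with $\bm M^\top\bm\Omega\bm M=2\pi\bm A$ for an antisymmetric integer matrix $\bm A$. $R_{\sqrt{2\pi}}$ maps each real coordinate to its representative modulo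 $\sqrt{2\pi}$ in $[-\sqrt{\pi/2},\sqrt{\pi/2})$. Code model: a GKP-stabilizer code is a triple $(\bm S_{\rm enc},\bm M,\bm f)$ with $\bm S_{\rm enc}\in{\rm Sp}(2K,\mathbb R)$, $\bm M$ a symplectically integral lattice generator (the ancilla GKP lattice), and $\bm f:\mathbb R^{2M}\to\mathbb R^{2N}$ measurable. The channel noise is $\bm\xi\sim\mathcal N(0,\sigma^2\bm I_{2K})$ (iid additive Gaussian noise); after decoding the noise is $\bm x=\bm S_{\rm enc}^{-1}\bm\xi=(\bm x_d,\bm x_a)$ with $\bm x_d\in\mathbb R^{2N}$, $\bm x_a\in\mathbb R^{2M}$; the syndrome is $\bm s=R_{\sqrt{2\pi}}(\bm M^\top\bm\Omega\bm x_a)$; the residual data error is $\bm\varepsilon=\bm x_d-\bm f(\bm s)$ with $\bm V_{\rm out}=\mathbb E[\bm\varepsilon\bm\varepsilon^\top]$; the geometric-mean error is $\bar\sigma^2_{\rm GM}=(\det\bm V_{\rm out})^{1/(2N)}$. A TMS code is a code whose encoding is $\bm T_{\bm G}$ for some gains. *)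

theory Defs
  imports "HOL-Probability.Probability" "Jordan_Normal_Form.Determinant"
begin

text \<open>Phase-space coordinates are 0-based: mode k occupies coordinates 2k (q) and 2k+1 (p).
  In the K = N + M mode space the data modes are 0..N-1, the ancilla modes N..N+M-1.\<close>

definition Omega :: "nat \<Rightarrow> real mat" where
  "Omega n = mat (2*n) (2*n) (\<lambda>(i,j).
      if even i \<and> j = i + 1 then 1 else if odd i \<and> j + 1 = i then -1 else 0)"

definition symplectic :: "nat \<Rightarrow> real mat \<Rightarrow> bool" where
  "symplectic n S \<longleftrightarrow> S \<in> carrier_mat (2*n) (2*n) \<and> S * Omega n * transpose_mat S = Omega n"

definition sympl_int_lattice :: "nat \<Rightarrow> real mat \<Rightarrow> bool" where
  "sympl_int_lattice m L \<longleftrightarrow> L \<in> carrier_mat (2*m) (2*m) \<and> invertible_mat L \<and>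
     (\<exists>A. A \<in> carrier_mat (2*m) (2*m) \<and> (\<forall>i<2*m. \<forall>j<2*m. A $$ (i,j) \<in> \<int>) \<and>
          transpose_mat A = - A \<and>
          transpose_mat L * Omega m * L = (2 * pi) \<cdot>\<^sub>m A)"

definition tms_enc :: "nat \<Rightarrow> nat \<Rightarrow> (nat \<Rightarrow> real) \<Rightarrow> real mat" where
  "tms_enc N M G = mat (2*(N+M)) (2*(N+M)) (\<lambda>(i,j).
     let a = i div 2; b = j div 2; sg = (if even i then 1 else -1) in
     if i mod 2 \<noteq> j mod 2 then 0
     else if a = b then (if a < N then sqrt (G a) else if a < 2*N then sqrt (G (a - N)) else 1)
     else if a < N \<and> b = N + a then sg * sqrt (G a - 1)
     else if b < N \<and> a = N + b then sg * sqrt (G b - 1)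
     else 0)"

definition inv_mat :: "nat \<Rightarrow> real mat \<Rightarrow> real mat" where
  "inv_mat n S = (SOME B. B \<in> carrier_mat n n \<and> S * B = 1\<^sub>m n \<and> B * S = 1\<^sub>m n)"

definition Rmod :: "real \<Rightarrow> real" where
  "Rmod t = t - sqrt (2*pi) * of_int \<lfloor>t / sqrt (2*pi) + 1/2\<rfloor>"

definition noise :: "nat \<Rightarrow> real \<Rightarrow> (nat \<Rightarrow> real) measure" where
  "noise d \<sigma> = PiM {..<d} (\<lambda>_. density lborel (normal_density 0 \<sigma>))"

definition estimator_measurable :: "nat \<Rightarrow> nat \<Rightarrow> ((nat \<Rightarrow> real) \<Rightarrow> (nat \<Rightarrow> real)) \<Rightarrow> bool" where
  "estimator_measurable N M f \<longleftrightarrow>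
     (\<forall>i<2*N. (\<lambda>s. f s i) \<in> borel_measurable (PiM {..<2*M} (\<lambda>_. borel)))"

definition gkp_code :: "nat \<Rightarrow> nat \<Rightarrow> real mat \<Rightarrow> real mat \<Rightarrow> ((nat \<Rightarrow> real) \<Rightarrow> (nat \<Rightarrow> real)) \<Rightarrow> bool" where
  "gkp_code N M S L f \<longleftrightarrow> symplectic (N+M) S \<and> sympl_int_lattice M L \<and> estimator_measurable N M f"

definition decoded_noise :: "nat \<Rightarrow> nat \<Rightarrow> real mat \<Rightarrow> (nat \<Rightarrow> real) \<Rightarrow> real vec" where
  "decoded_noise N M S \<xi> = inv_mat (2*(N+M)) S *\<^sub>v vec (2*(N+M)) \<xi>"

definition syndrome :: "nat \<Rightarrow> nat \<Rightarrow> real mat \<Rightarrow> real mat \<Rightarrow> (nat \<Rightarrow> real) \<Rightarrow> (nat \<Rightarrow> real)" where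
  "syndrome N M S L \<xi> =
     (let x = decoded_noise N M S \<xi>;
          xa = vec (2*M) (\<lambda>i. x $ (2*N + i));
          y = transpose_mat L *\<^sub>v (Omega M *\<^sub>v xa)
      in (\<lambda>i. if i < 2*M then Rmod (y $ i) else undefined))"

definition residual :: "nat \<Rightarrow> nat \<Rightarrow> real mat \<Rightarrow> real mat \<Rightarrow> ((nat \<Rightarrow> real) \<Rightarrow> (nat \<Rightarrow> real))
     \<Rightarrow> (nat \<Rightarrow> real) \<Rightarrow> nat \<Rightarrow> real" where
  "residual N M S L f \<xi> i = decoded_noise N M S \<xi> $ i - f (syndrome N M S L \<xi>) i"

definition V_out :: "nat \<Rightarrow> nat \<Rightarrow> real \<Rightarrow> real mat \<Rightarrow> real mat \<Rightarrow> ((nat \<Rightarrow> real) \<Rightarrow> (nat \<Rightarrow> real)) \<Rightarrow> real mat" where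
  "V_out N M \<sigma> S L f = mat (2*N) (2*N) (\<lambda>(i,j).
      integral\<^sup>L (noise (2*(N+M)) \<sigma>) (\<lambda>\<xi>. residual N M S L f \<xi> i * residual N M S L f \<xi> j))"

text \<open>Finite second moments of the residual error (so that V_out is well defined).\<close>
definition finite_error :: "nat \<Rightarrow> nat \<Rightarrow> real \<Rightarrow> real mat \<Rightarrow> real mat \<Rightarrow> ((nat \<Rightarrow> real) \<Rightarrow> (nat \<Rightarrow> real)) \<Rightarrow> bool" where
  "finite_error N M \<sigma> S L f \<longleftrightarrow>
     (\<forall>i<2*N. integrable (noise (2*(N+M)) \<sigma>) (\<lambda>\<xi>. (residual N M S L f \<xi> i)\<^sup>2))"

definition gm_error :: "nat \<Rightarrow> nat \<Rightarrow> real \<Rightarrow> real mat \<Rightarrow> real mat \<Rightarrow> ((nat \<Rightarrow> real) \<Rightarrow> (nat \<Rightarrow> real)) \<Rightarrow> real" where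
  "gm_error N M \<sigma> S L f = det (V_out N M \<sigma> S L f) powr (1 / real (2*N))"

end

theory Submission
  imports Defs "Jordan_Normal_Form.Spectral_Radius"
begin

text \<open>Every symplectic S factors as Q T P, where Q is orthogonal, T is a two-mode squeezing encoding
  and P is block diagonal with symplectic blocks A (data) and D (ancilla). This is the modewise
  (Schmidt) decomposition of the pure Gaussian state with covariance matrix inverse (transpose S * S):
  Williamson's normal form of the data subspace fixes the gains and the data halves of the squeezed
  pairs, the complex structure produces their ancilla partners, and a unitary completion supplies the
  remaining modes. Isotropic Gaussian noise is invariant under the transpose of Q, so decoding with T
  amounts to decoding with S followed by P. The block D is absorbed into the lattice without changing
  the syndrome, and A is absorbed into the estimator; the residual covariance V becomes
  A V (transpose A), which has the same determinant since det A squared is 1.\<close>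

section \<open>Orthonormal families\<close>

text \<open>Only the data columns have to be matched. Once a symplectic X = Q T has its first 2N
  columns in the span of the first 2N columns of S, these are symplectically orthogonal to the
  ancilla columns of S, so the upper right block of P = X^-1 S vanishes; the lower left block then
  vanishes too, because P is symplectic. The ancilla side of S is never normalized: D collects
  whatever is left there.

  The gains come from lengths. Normal-form vectors e, f with e . J f = 1 and equal squared length
  \<nu> must be data columns of Q T, and such a column has squared length G + (G - 1); hence G =
  (\<nu> + 1) / 2, and \<nu> \<ge> 1 is the uncertainty bound.

  The delicate case is G = 1: the ancilla partner of the pair degenerates to 0 and cannot be
  normalized, which is why a completion over an index set with holes is required.

  On the analytic side everything up to the residual is a pointwise identity in the noise;
  probability enters only through invariance under the transpose of Q. Finite second moments then
  justify expanding the covariance bilinearly, since the Bochner integral of a non-integrable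
  function is 0 by convention.\<close>

text \<open>Vectors are functions on the naturals of which only the coordinates below the dimension matter.\<close>

definition dot :: "nat \<Rightarrow> (nat \<Rightarrow> real) \<Rightarrow> (nat \<Rightarrow> real) \<Rightarrow> real" where
  "dot n x y = (\<Sum>i<n. x i * y i)"

lemma dot_commute: "dot n x y = dot n y x"
  by (simp add: dot_def mult.commute)

lemma dot_cong: "(\<And>i. i < n \<Longrightarrow> x i = x' i) \<Longrightarrow> (\<And>i. i < n \<Longrightarrow> y i = y' i) \<Longrightarrow> dot n x y = dot n x' y'"
  by (simp add: dot_def)

lemma dot_nonneg: "0 \<le> dot n x x"
  by (simp add: dot_def sum_nonneg)

lemma dot_self_eq_0: "dot n x x = 0 \<longleftrightarrow> (\<forall>i<n. x i = 0)"
  by (auto simp: dot_def sum_nonneg_eq_0_iff)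

lemma dot_add_left: "dot n (\<lambda>i. x i + y i) z = dot n x z + dot n y z"
  and dot_add_right: "dot n z (\<lambda>i. x i + y i) = dot n z x + dot n z y"
  and dot_diff_left: "dot n (\<lambda>i. x i - y i) z = dot n x z - dot n y z"
  and dot_diff_right: "dot n z (\<lambda>i. x i - y i) = dot n z x - dot n z y"
  and dot_minus_left: "dot n (\<lambda>i. - x i) z = - dot n x z"
  and dot_minus_right: "dot n z (\<lambda>i. - x i) = - dot n z x"
  and dot_scale_left: "dot n (\<lambda>i. c * x i) z = c * dot n x z"
  and dot_scale_right: "dot n z (\<lambda>i. c * x i) = c * dot n z x"
  by (simp_all add: dot_def algebra_simps sum.distrib sum_subtractf sum_negf sum_distrib_left)

lemma dot_sum_left: "dot n (\<lambda>i. \<Sum>k\<in>A. c k * y k i) z = (\<Sum>k\<in>A. c k * dot n (y k) z)"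
  unfolding dot_def by (simp add: sum_distrib_right sum_distrib_left mult.assoc) (rule sum.swap)

lemma dot_sum_right: "dot n z (\<lambda>i. \<Sum>k\<in>A. c k * y k i) = (\<Sum>k\<in>A. c k * dot n z (y k))"
  using dot_sum_left[of n c y A z] by (simp add: dot_commute)

lemmas dot_linear = dot_add_left dot_add_right dot_diff_left dot_diff_right dot_minus_left
  dot_minus_right dot_scale_left dot_scale_right dot_sum_left dot_sum_right

text \<open>Fewer than n linear conditions in dimension n: padding the rows by zeros gives a square
  matrix with a zero row, hence determinant 0 and a nonzero kernel vector.\<close>

lemma exists_orthogonal_vector:
  assumes "length us < n"
  shows "\<exists>v. dot n v v \<noteq> 0 \<and> (\<forall>u\<in>set us. dot n u v = 0)"
proof -
  define A where "A = mat n n (\<lambda>(i,j). if i < length us then (us ! i) j else 0 :: real)"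
  have A: "A \<in> carrier_mat n n" by (simp add: A_def)
  have "det A = 0"
  proof -
    define r where "r = row A"
    have "A = mat\<^sub>r n n (\<lambda>i. if i = length us then 0\<^sub>v n else r i)"
      using assms by (intro eq_matI) (auto simp: A_def r_def)
    moreover have "det (mat\<^sub>r n n (\<lambda>i. if i = length us then 0\<^sub>v n else r i)) = 0"
      using A by (intro det_row_0[OF assms]) (auto simp: r_def)
    ultimately show ?thesis by (rule ssubst)
  qed
  then obtain v where v: "v \<in> carrier_vec n" "v \<noteq> 0\<^sub>v n" "A *\<^sub>v v = 0\<^sub>v n"
    using det_0_iff_vec_prod_zero_field[OF A] by blast
  have "dot n u (\<lambda>i. v $ i) = 0" if u: "u \<in> set us" for u
  proof -
    from u obtain k where k: "k < length us" "u = us ! k" by (auto simp: in_set_conv_nth)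
    have "(A *\<^sub>v v) $ k = 0" using v k assms by simp
    moreover have "(A *\<^sub>v v) $ k = dot n u (\<lambda>i. v $ i)"
      using k assms v(1) by (simp add: A_def scalar_prod_def dot_def lessThan_atLeast0)
    ultimately show ?thesis by simp
  qed
  moreover have "dot n (\<lambda>i. v $ i) (\<lambda>i. v $ i) \<noteq> 0"
    using v(1,2) by (auto simp: dot_self_eq_0 intro: eq_vecI)
  ultimately show ?thesis by blast
qed

definition orthonormal :: "nat \<Rightarrow> nat \<Rightarrow> (nat \<Rightarrow> nat \<Rightarrow> real) \<Rightarrow> bool" where
  "orthonormal n m Y \<longleftrightarrow> (\<forall>i<m. \<forall>j<m. dot n (Y i) (Y j) = (if i = j then 1 else 0))"

text \<open>With m > n the n coordinate equations for a combination of the m vectors have a nonzero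
  solution t, so the combination vanishes; by orthonormality its squared length is that of
  t.\<close>

lemma orthonormal_le_dim:
  assumes "orthonormal n m Y" shows "m \<le> n"
proof (rule ccontr)
  assume "\<not> m \<le> n"
  then obtain t where t: "dot m t t \<noteq> 0" "\<And>i. i < n \<Longrightarrow> dot m (\<lambda>k. Y k i) t = 0"
    using exists_orthogonal_vector[of "map (\<lambda>i k. Y k i) [0..<n]" m] by auto
  let ?z = "\<lambda>i. \<Sum>k<m. t k * Y k i"
  have "dot n ?z ?z = (\<Sum>k<m. t k * (\<Sum>l<m. t l * dot n (Y l) (Y k)))"
    by (simp only: dot_sum_right) (simp add: dot_sum_left)
  also have "\<dots> = (\<Sum>k<m. t k * (\<Sum>l<m. if l = k then t l else 0))"
    using assms by (intro sum.cong refl arg_cong2[where f = "(*)"]) (auto simp: orthonormal_def)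
  also have "\<dots> = dot m t t" by (simp add: dot_def)
  finally have "dot n ?z ?z \<noteq> 0" using t by simp
  moreover have "?z i = 0" if "i < n" for i
    using t(2)[OF that] by (simp add: dot_def mult.commute)
  ultimately show False by (simp add: dot_def)
qed

lemma unit_vector:
  assumes "dot n v v \<noteq> 0" shows "dot n (\<lambda>i. 1 / sqrt (dot n v v) * v i) (\<lambda>i. 1 / sqrt (dot n v v) * v i) = 1"
  using assms dot_nonneg[of n v] by (simp only: dot_scale_left dot_scale_right) (simp add: field_simps)

text \<open>A family of maximal size works: a nonzero remainder of some x after projection could be
  normalized and adjoined. The dimension bound is an inequality because us may be linearly
  dependent.\<close>

lemma orthonormal_basis_of_complement:
  obtains m Y where "orthonormal n m Y" "n \<le> m + length us"
    "\<forall>p<m. \<forall>u\<in>set us. dot n (Y p) u = 0"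
    "\<forall>x. (\<forall>u\<in>set us. dot n x u = 0) \<longrightarrow> (\<forall>i<n. x i = (\<Sum>p<m. dot n x (Y p) * Y p i))"
proof -
  define good where "good m \<longleftrightarrow> (\<exists>Y. orthonormal n m Y \<and> (\<forall>p<m. \<forall>u\<in>set us. dot n (Y p) u = 0))" for m
  have "good 0" by (simp add: good_def orthonormal_def)
  moreover have bd: "\<forall>m. good m \<longrightarrow> m \<le> n" using orthonormal_le_dim by (auto simp: good_def)
  ultimately have g: "good (GREATEST m. good m)" and mx: "\<And>m. good m \<Longrightarrow> m \<le> (GREATEST m. good m)"
    using GreatestI_nat[of good 0 n] Greatest_le_nat[of good _ n] by auto
  define m where "m = (GREATEST m. good m)"
  obtain Y where Y: "orthonormal n m Y" "\<And>p u. p < m \<Longrightarrow> u \<in> set us \<Longrightarrow> dot n (Y p) u = 0"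
    using g[folded m_def] unfolding good_def by blast
  \<comment> \<open>Maximality of m: a nonzero z orthogonal to us and to all of Y would extend the
    family to size Suc m.\<close>
  have zero: "dot n z z = 0" if z: "\<And>u. u \<in> set us \<Longrightarrow> dot n z u = 0" "\<And>p. p < m \<Longrightarrow> dot n z (Y p) = 0" for z
  proof (rule ccontr)
    assume nz: "dot n z z \<noteq> 0"
    define y where "y = (\<lambda>i. 1 / sqrt (dot n z z) * z i)"
    have "orthonormal n (Suc m) (Y(m := y))"
      unfolding orthonormal_def
    proof (intro allI impI)
      fix i j assume "i < Suc m" "j < Suc m"
      moreover have "dot n y y = 1" unfolding y_def using unit_vector[OF nz] .
      moreover have "dot n y (Y p) = 0" "dot n (Y p) y = 0" if "p < m" for p
        using z(2)[OF that] dot_commute[of n "Y p" y] unfolding y_def dot_scale_left by auto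
      ultimately show "dot n ((Y(m := y)) i) ((Y(m := y)) j) = (if i = j then 1 else 0)"
        using Y(1) by (auto simp: orthonormal_def less_Suc_eq)
    qed
    moreover have "\<forall>p<Suc m. \<forall>u\<in>set us. dot n ((Y(m := y)) p) u = 0"
      using Y(2) z(1) unfolding y_def by (auto simp: less_Suc_eq dot_scale_left simp del: times_divide_eq_left)
    ultimately have "good (Suc m)" unfolding good_def by blast
    then show False using mx[of "Suc m"] by (simp add: m_def)
  qed
  have ex: "x i = (\<Sum>p<m. dot n x (Y p) * Y p i)"
    if x: "\<And>u. u \<in> set us \<Longrightarrow> dot n x u = 0" and i: "i < n" for x i
  proof -
    let ?z = "\<lambda>i. x i - (\<Sum>p<m. dot n x (Y p) * Y p i)"
    have "dot n ?z ?z = 0"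
    proof (rule zero)
      show "dot n ?z u = 0" if "u \<in> set us" for u
        using that x Y(2) by (simp add: dot_diff_left dot_sum_left)
      show "dot n ?z (Y p) = 0" if "p < m" for p
      proof -
        have "(\<Sum>q<m. dot n x (Y q) * dot n (Y q) (Y p)) = (\<Sum>q<m. if q = p then dot n x (Y q) else 0)"
          using that Y(1) by (intro sum.cong) (auto simp: orthonormal_def)
        then show ?thesis using that by (simp add: dot_diff_left dot_sum_left)
      qed
    qed
    then show ?thesis using i by (simp add: dot_self_eq_0)
  qed
  have le: "n \<le> m + length us"
  proof (rule ccontr)
    assume "\<not> ?thesis"
    then obtain v where v: "dot n v v \<noteq> 0" "\<forall>u\<in>set (us @ map Y [0..<m]). dot n u v = 0"
      using exists_orthogonal_vector[of "us @ map Y [0..<m]" n] by fastforce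
    have "dot n v u = 0" if "u \<in> set us \<or> u \<in> Y ` {0..<m}" for u
      using v(2) that dot_commute[of n v u] by auto
    then show False using zero[of v] v(1) by auto
  qed
  show ?thesis using that[OF Y(1) le] Y(2) ex by blast
qed

text \<open>A complex eigenvector u + i w exists, and skewness makes its eigenvalue i \<beta> purely
  imaginary; the two equations are its real and imaginary parts. The case \<beta> = 0 is still
  possible here.\<close>

lemma skew_eigenpair:
  fixes k :: "nat \<Rightarrow> nat \<Rightarrow> real"
  assumes "m > 0" and skew: "\<And>p q. p < m \<Longrightarrow> q < m \<Longrightarrow> k q p = - k p q"
  obtains u w \<beta> where "dot m u u + dot m w w > 0"
    "\<forall>p<m. dot m (k p) u = - \<beta> * w p" "\<forall>p<m. dot m (k p) w = \<beta> * u p"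
proof -
  define A where "A = mat m m (\<lambda>(p,q). complex_of_real (k p q))"
  have A: "A \<in> carrier_mat m m" by (simp add: A_def)
  obtain l v where "eigenvector A v l"
    using spectrum_non_empty[OF A \<open>m > 0\<close>] by (auto simp: spectrum_def eigenvalue_def)
  then have v: "v \<in> carrier_vec m" "v \<noteq> 0\<^sub>v m" "A *\<^sub>v v = l \<cdot>\<^sub>v v"
    using A by (auto simp: eigenvector_def)
  define u w where "u p = Re (v $ p)" and "w p = Im (v $ p)" for p
  have ev: "(\<Sum>q<m. complex_of_real (k p q) * v $ q) = l * v $ p" if "p < m" for p
  proof -
    have "(A *\<^sub>v v) $ p = l * v $ p" using v that by simp
    then show ?thesis using that v(1) by (simp add: A_def scalar_prod_def lessThan_atLeast0)
  qed
  have ku: "dot m (k p) u = Re l * u p - Im l * w p" if "p < m" for p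
    using arg_cong[OF ev[OF that], of Re] by (simp add: dot_def u_def w_def)
  have kw: "dot m (k p) w = Re l * w p + Im l * u p" if "p < m" for p
    using arg_cong[OF ev[OF that], of Im] by (simp add: dot_def u_def w_def algebra_simps)
  have quad: "(\<Sum>p<m. x p * dot m (k p) x) = 0" for x
  proof -
    have "(\<Sum>p<m. x p * dot m (k p) x) = (\<Sum>p<m. \<Sum>q<m. x p * k p q * x q)"
      by (simp add: dot_def sum_distrib_left mult.assoc)
    also have "\<dots> = (\<Sum>q<m. \<Sum>p<m. x p * k p q * x q)" by (rule sum.swap)
    also have "\<dots> = (\<Sum>q<m. \<Sum>p<m. - (x q * k q p * x p))"
    proof (intro sum.cong refl)
      fix q p assume "q \<in> {..<m}" "p \<in> {..<m}"
      then have "k p q = - k q p" using skew[of q p] by simp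
      then show "x p * k p q * x q = - (x q * k q p * x p)" by simp
    qed
    also have "\<dots> = - (\<Sum>p<m. x p * dot m (k p) x)"
      by (simp add: dot_def sum_distrib_left mult.assoc sum_negf)
    finally show ?thesis by simp
  qed
  have pos: "dot m u u + dot m w w > 0"
  proof -
    have "\<not> (dot m u u = 0 \<and> dot m w w = 0)"
      using v(1,2) by (auto simp: dot_self_eq_0 u_def w_def complex_eq_iff intro!: eq_vecI)
    then show ?thesis using dot_nonneg[of m u] dot_nonneg[of m w] by linarith
  qed
  \<comment> \<open>Adding this equation and the next, the Im l terms cancel by symmetry of
    \<open>dot\<close>, and Re l times the total squared length remains.\<close>
  have "0 = dot m u (\<lambda>p. Re l * u p - Im l * w p)"
    using quad[of u] ku by (simp add: dot_def[of m u])
  moreover have "0 = dot m w (\<lambda>p. Re l * w p + Im l * u p)"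
    using quad[of w] kw by (simp add: dot_def[of m w])
  ultimately have "Re l * (dot m u u + dot m w w) = 0"
    by (simp add: dot_linear dot_commute[of m w u] algebra_simps)
  then have "Re l = 0" using pos by simp
  then have "dot m (k p) u = - Im l * w p" "dot m (k p) w = Im l * u p" if "p < m" for p
    using ku[OF that] kw[OF that] by auto
  then show ?thesis using that[OF pos] by blast
qed

section \<open>Williamson normal form and unitary completion\<close>

text \<open>Multiplication by Omega, independently of the number of modes.\<close>

definition Jmul :: "(nat \<Rightarrow> real) \<Rightarrow> nat \<Rightarrow> real" where
  "Jmul x i = (if even i then x (Suc i) else - x (i - 1))"

lemma Jmul_linear:
  "Jmul (\<lambda>i. x i + y i) = (\<lambda>i. Jmul x i + Jmul y i)"
  "Jmul (\<lambda>i. x i - y i) = (\<lambda>i. Jmul x i - Jmul y i)"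
  "Jmul (\<lambda>i. - x i) = (\<lambda>i. - Jmul x i)"
  "Jmul (\<lambda>i. c * x i) = (\<lambda>i. c * Jmul x i)"
  by (auto simp: Jmul_def fun_eq_iff)

lemma Jmul_sum: "Jmul (\<lambda>i. \<Sum>k\<in>A. c k * y k i) = (\<lambda>i. \<Sum>k\<in>A. c k * Jmul (y k) i)"
  by (auto simp: Jmul_def fun_eq_iff sum_negf)

lemma Jmul_Jmul: "Jmul (Jmul x) = (\<lambda>i. - x i)"
  by (auto simp: Jmul_def fun_eq_iff)

text \<open>The dimension is even so that J pairs the coordinates 2l and 2l+1 without reading beyond
  the range; the induction adds one mode at a time.\<close>

lemma dot_Jmul_Jmul: "dot (2*k) (Jmul x) (Jmul y) = dot (2*k) x y"
  by (induction k) (simp_all add: dot_def Jmul_def)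

lemma dot_Jmul_left: "dot (2*k) (Jmul x) y = - dot (2*k) x (Jmul y)"
  by (induction k) (simp_all add: dot_def Jmul_def)

lemma dot_Jmul_commute: "dot (2*k) x (Jmul y) = - dot (2*k) y (Jmul x)"
  using dot_Jmul_left[of k y x] dot_commute[of "2*k" "Jmul y" x] by simp

lemma dot_Jmul_self: "dot (2*k) x (Jmul x) = 0"
  using dot_Jmul_commute[of k x x] by simp

text \<open>The planes are found one at a time: the compression of the skew map to the vectors of U
  orthogonal to the planes found so far has a purely imaginary eigenvalue, and the real and
  imaginary parts of an eigenvector span the next plane.\<close>

lemma williamson_in_complement:
  fixes us :: "(nat \<Rightarrow> real) list" and k :: nat
  defines "U \<equiv> {x. \<forall>u\<in>set us. dot (2*k) x u = 0}"
  assumes nondeg: "\<And>z. z \<in> U \<Longrightarrow> (\<And>x. x \<in> U \<Longrightarrow> dot (2*k) x (Jmul z) = 0) \<Longrightarrow> dot (2*k) z z = 0"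
  shows "length us + 2*r \<le> 2*k \<Longrightarrow> \<exists>a c \<alpha>. \<forall>i<r. \<alpha> i > 0 \<and> a i \<in> U \<and> c i \<in> U \<and>
     (\<forall>j<r. dot (2*k) (a i) (a j) = (if i = j then 1 else 0) \<and>
            dot (2*k) (c i) (c j) = (if i = j then 1 else 0) \<and> dot (2*k) (a i) (c j) = 0) \<and>
     (\<forall>x\<in>U. dot (2*k) x (Jmul (c i)) = \<alpha> i * dot (2*k) x (a i) \<and>
             dot (2*k) x (Jmul (a i)) = - \<alpha> i * dot (2*k) x (c i))"
proof (induction r)
  case 0
  then show ?case by simp
next
  case (Suc r)
  define n where "n = 2*k"
  obtain a c \<alpha> where H: "\<forall>i<r. \<alpha> i > 0 \<and> a i \<in> U \<and> c i \<in> U \<and>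
     (\<forall>j<r. dot n (a i) (a j) = (if i = j then 1 else 0) \<and>
            dot n (c i) (c j) = (if i = j then 1 else 0) \<and> dot n (a i) (c j) = 0) \<and>
     (\<forall>x\<in>U. dot n x (Jmul (c i)) = \<alpha> i * dot n x (a i) \<and>
             dot n x (Jmul (a i)) = - \<alpha> i * dot n x (c i))"
    using Suc unfolding n_def by auto
  have IH: "\<And>i. i < r \<Longrightarrow> \<alpha> i > 0" "\<And>i. i < r \<Longrightarrow> a i \<in> U" "\<And>i. i < r \<Longrightarrow> c i \<in> U"
    "\<And>i j. i < r \<Longrightarrow> j < r \<Longrightarrow> dot n (a i) (a j) = (if i = j then 1 else 0)"
    "\<And>i j. i < r \<Longrightarrow> j < r \<Longrightarrow> dot n (c i) (c j) = (if i = j then 1 else 0)"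
    "\<And>i j. i < r \<Longrightarrow> j < r \<Longrightarrow> dot n (a i) (c j) = 0"
    "\<And>i x. i < r \<Longrightarrow> x \<in> U \<Longrightarrow> dot n x (Jmul (c i)) = \<alpha> i * dot n x (a i)"
    "\<And>i x. i < r \<Longrightarrow> x \<in> U \<Longrightarrow> dot n x (Jmul (a i)) = - \<alpha> i * dot n x (c i)"
    using H by blast+
  have Jc: "dot n x (Jmul y) = - dot n y (Jmul x)" for x y
    unfolding n_def by (rule dot_Jmul_commute)
  have U_iff: "x \<in> U \<longleftrightarrow> (\<forall>u\<in>set us. dot n x u = 0)" for x by (simp add: U_def n_def)
  define vs where "vs = us @ map a [0..<r] @ map c [0..<r]"
  have vs: "(\<forall>u\<in>set vs. dot n x u = 0) \<longleftrightarrow>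
      x \<in> U \<and> (\<forall>i<r. dot n x (a i) = 0) \<and> (\<forall>i<r. dot n x (c i) = 0)" for x
    by (auto simp: vs_def U_iff)
  obtain m Y where Y: "orthonormal n m Y" "n \<le> m + length vs"
    "\<forall>p<m. \<forall>u\<in>set vs. dot n (Y p) u = 0"
    "\<forall>x. (\<forall>u\<in>set vs. dot n x u = 0) \<longrightarrow> (\<forall>i<n. x i = (\<Sum>p<m. dot n x (Y p) * Y p i))"
    by (rule orthonormal_basis_of_complement[of n vs])
  \<comment> \<open>Room for another plane: vs has length us + 2*r members, which is at most 2*k -
    2.\<close>
  have "m > 0" using Y(2) Suc.prems by (simp add: vs_def n_def)
  obtain u w \<beta> where uw: "dot m u u + dot m w w > 0"
    "\<forall>p<m. dot m (\<lambda>q. dot n (Y p) (Jmul (Y q))) u = - \<beta> * w p"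
    "\<forall>p<m. dot m (\<lambda>q. dot n (Y p) (Jmul (Y q))) w = \<beta> * u p"
    by (rule skew_eigenpair[of m "\<lambda>p q. dot n (Y p) (Jmul (Y q))", OF \<open>m > 0\<close> Jc])
  define a0 c0 where "a0 = (\<lambda>i. \<Sum>q<m. u q * Y q i)" and "c0 = (\<lambda>i. \<Sum>q<m. w q * Y q i)"
  have YJ: "dot n (Y p) (Jmul (\<lambda>i. \<Sum>q<m. t q * Y q i)) = dot m (\<lambda>q. dot n (Y p) (Jmul (Y q))) t" for p t
    by (simp add: Jmul_sum dot_sum_right dot_def[of m] mult.commute)
  have Yt: "dot n (Y p) (\<lambda>i. \<Sum>q<m. t q * Y q i) = t p" if "p < m" for p t
  proof -
    have "dot n (Y p) (\<lambda>i. \<Sum>q<m. t q * Y q i) = (\<Sum>q<m. if q = p then t q else 0)"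
      unfolding dot_sum_right using that Y(1) by (intro sum.cong) (auto simp: orthonormal_def)
    then show ?thesis using that by simp
  qed
  have Ya: "dot n (Y p) (Jmul c0) = \<beta> * dot n (Y p) a0" and Yc: "dot n (Y p) (Jmul a0) = - \<beta> * dot n (Y p) c0"
    if "p < m" for p
    unfolding a0_def c0_def YJ using uw that by (simp_all add: Yt)
  have "dot n a0 u = 0" "dot n c0 u = 0" if "u \<in> set vs" for u
    using that Y(3) by (simp_all add: a0_def c0_def dot_sum_left)
  then have perp: "a0 \<in> U" "c0 \<in> U" "\<And>i. i < r \<Longrightarrow> dot n a0 (a i) = 0" "\<And>i. i < r \<Longrightarrow> dot n a0 (c i) = 0"
      "\<And>i. i < r \<Longrightarrow> dot n c0 (a i) = 0" "\<And>i. i < r \<Longrightarrow> dot n c0 (c i) = 0"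
    using vs[of a0] vs[of c0] by auto
  have exp: "dot n x z = (\<Sum>p<m. dot n x (Y p) * dot n (Y p) z)" if "\<And>u. u \<in> set vs \<Longrightarrow> dot n x u = 0" for x z
    using Y(4) that by (subst dot_sum_left[symmetric]) (rule dot_cong, auto)
  \<comment> \<open>So far the eigenvector equations are known only against the basis
    \<open>Y\<close>. An arbitrary x in U differs from the span of \<open>Y\<close> by its
    projection onto the earlier planes, and by the induction hypothesis those planes contribute 0 to
    both sides.\<close>
  have eqU: "dot n x (Jmul c0) = \<beta> * dot n x a0 \<and> dot n x (Jmul a0) = - \<beta> * dot n x c0" if x: "x \<in> U" for x
  proof -
    define x' where "x' = (\<lambda>j. x j - ((\<Sum>i<r. dot n x (a i) * a i j) + (\<Sum>i<r. dot n x (c i) * c i j)))"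
    have dx': "dot n x' z = dot n x z - ((\<Sum>i<r. dot n x (a i) * dot n (a i) z) + (\<Sum>i<r. dot n x (c i) * dot n (c i) z))" for z
      by (simp add: x'_def dot_linear)
    have ca: "dot n (c i) (a j) = 0" if "i < r" "j < r" for i j using IH(6)[of j i] that dot_commute by metis
    have x': "dot n x' v = 0" if v: "v \<in> set vs" for v
    proof -
      consider "v \<in> set us" | i where "i < r" "v = a i" | i where "i < r" "v = c i" using v by (auto simp: vs_def)
      then show ?thesis
      proof cases
        case 1
        then show ?thesis using x IH(2,3) unfolding dx' by (simp add: U_iff)
      next
        case 2
        then have "(\<Sum>l<r. dot n x (a l) * dot n (a l) v) = (\<Sum>l<r. if l = i then dot n x (a l) else 0)"
          by (intro sum.cong) (auto simp: IH(4))
        then show ?thesis using 2 unfolding dx' by (simp add: ca)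
      next
        case 3
        then have "(\<Sum>l<r. dot n x (c l) * dot n (c l) v) = (\<Sum>l<r. if l = i then dot n x (c l) else 0)"
          by (intro sum.cong) (auto simp: IH(5))
        then show ?thesis using 3 unfolding dx' by (simp add: IH(6))
      qed
    qed
    have z: "dot n (a i) (Jmul c0) = 0" "dot n (a i) (Jmul a0) = 0" "dot n (c i) (Jmul c0) = 0"
        "dot n (c i) (Jmul a0) = 0" "dot n (a i) a0 = 0" "dot n (a i) c0 = 0" "dot n (c i) a0 = 0"
        "dot n (c i) c0 = 0" if "i < r" for i
      using Jc[of "a i" c0] Jc[of "a i" a0] Jc[of "c i" c0] Jc[of "c i" a0] perp that IH(7,8)
      by (auto simp: dot_commute)
    have E: "dot n x' (Jmul y) = b * dot n x' z"
      if "\<And>p. p < m \<Longrightarrow> dot n (Y p) (Jmul y) = b * dot n (Y p) z" for y z b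
    proof -
      have "dot n x' (Jmul y) = (\<Sum>p<m. dot n x' (Y p) * dot n (Y p) (Jmul y))" by (rule exp[OF x'])
      also have "\<dots> = b * (\<Sum>p<m. dot n x' (Y p) * dot n (Y p) z)"
        by (simp add: that sum_distrib_left mult.left_commute)
      also have "\<dots> = b * dot n x' z" using exp[OF x', of z] by simp
      finally show ?thesis .
    qed
    have "dot n x' (Jmul c0) = \<beta> * dot n x' a0" "dot n x' (Jmul a0) = - \<beta> * dot n x' c0"
      using E[OF Ya] E[OF Yc] by auto
    then show ?thesis unfolding dx' by (simp add: z)
  qed
  have nz: "dot n a0 a0 + dot n c0 c0 > 0"
    using uw(1) by (simp add: a0_def c0_def dot_sum_left Yt) (simp add: dot_def)
  \<comment> \<open>Otherwise a0 and c0 would lie in the radical of the symplectic form on U, which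
    nondeg excludes.\<close>
  have "\<beta> \<noteq> 0"
  proof
    assume "\<beta> = 0"
    then have "dot n a0 a0 = 0" "dot n c0 c0 = 0"
      using nondeg[of a0] nondeg[of c0] eqU perp by (auto simp: n_def)
    then show False using nz by simp
  qed
  \<comment> \<open>Since \<beta> is nonzero, testing the first equation with c0 gives
    orthogonality; testing crosswise and using antisymmetry gives equal lengths. Both vectors are
    therefore nonzero.\<close>
  have "dot n c0 (Jmul c0) = 0" unfolding n_def by (rule dot_Jmul_self)
  then have ac: "dot n a0 c0 = 0" using eqU[OF perp(2)] \<open>\<beta> \<noteq> 0\<close> by (simp add: dot_commute)
  have same: "dot n a0 a0 = dot n c0 c0"
    using eqU[OF perp(2)] eqU[OF perp(1)] Jc[of a0 c0] \<open>\<beta> \<noteq> 0\<close> by simp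
  define s where "s = dot n a0 a0"
  have s: "s > 0" "dot n a0 a0 = s" "dot n c0 c0 = s" using nz same by (auto simp: s_def)
  \<comment> \<open>The factor sgn \<beta> flips the second vector where necessary, so that the
    coefficient becomes \<bar>\<beta>\<bar>, which is positive.\<close>
  define ar cr where "ar = (\<lambda>i. 1 / sqrt s * a0 i)" and "cr = (\<lambda>i. sgn \<beta> / sqrt s * c0 i)"
  have sg: "sgn \<beta> * sgn \<beta> = 1" "\<bar>\<beta>\<bar> = sgn \<beta> * \<beta>" "\<beta> = sgn \<beta> * \<bar>\<beta>\<bar>" using \<open>\<beta> \<noteq> 0\<close> by (auto simp: sgn_if)
  have dr: "dot n x ar = 1 / sqrt s * dot n x a0" "dot n x cr = sgn \<beta> / sqrt s * dot n x c0"
    "dot n x (Jmul ar) = 1 / sqrt s * dot n x (Jmul a0)" "dot n x (Jmul cr) = sgn \<beta> / sqrt s * dot n x (Jmul c0)"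
    "dot n ar x = 1 / sqrt s * dot n a0 x" "dot n cr x = sgn \<beta> / sqrt s * dot n c0 x" for x
    unfolding ar_def cr_def Jmul_linear dot_linear by auto
  have ss: "sqrt s * sqrt s = s" "sqrt s > 0" using s by auto
  have new1: "dot n ar ar = 1" "dot n cr cr = 1" "dot n ar cr = 0"
    unfolding dr using s ss sg ac by (auto simp: field_simps)
  have new2: "ar \<in> U" "cr \<in> U" using perp unfolding U_iff dr by auto
  have new3: "dot n ar (a i) = 0" "dot n ar (c i) = 0" "dot n cr (a i) = 0" "dot n cr (c i) = 0"
      "dot n (a i) ar = 0" "dot n (c i) ar = 0" "dot n (a i) cr = 0" "dot n (c i) cr = 0" if "i < r" for i
    using perp that unfolding dr by (auto simp: dot_commute)
  have new4: "dot n x (Jmul cr) = \<bar>\<beta>\<bar> * dot n x ar" "dot n x (Jmul ar) = - \<bar>\<beta>\<bar> * dot n x cr" if "x \<in> U" for x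
    unfolding dr using eqU[OF that] sg \<open>\<beta> \<noteq> 0\<close> by (auto simp: sgn_if)
  show ?case
    unfolding n_def[symmetric]
    apply (rule exI[of _ "a(r := ar)"], rule exI[of _ "c(r := cr)"], rule exI[of _ "\<alpha>(r := \<bar>\<beta>\<bar>)"])
    using new1 new2 new3 new4 IH \<open>\<beta> \<noteq> 0\<close> by (auto simp: less_Suc_eq)
qed

text \<open>Orthogonality to both q i and J (q i) is Hermitian orthogonality for the complex
  structure J. As long as an index is missing, these are 2 * card I < 2*k real conditions, so
  another vector exists. The set I is arbitrary, not an initial segment, because the given indices
  may have holes.\<close>

lemma unitary_completion:
  fixes q :: "nat \<Rightarrow> nat \<Rightarrow> real"
  assumes "finite I" "I \<subseteq> {..<k}"
    "\<And>i j. i \<in> I \<Longrightarrow> j \<in> I \<Longrightarrow> dot (2*k) (q i) (q j) = (if i = j then 1 else 0)"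
    "\<And>i j. i \<in> I \<Longrightarrow> j \<in> I \<Longrightarrow> dot (2*k) (q i) (Jmul (q j)) = 0"
  shows "\<exists>q'. (\<forall>i\<in>I. q' i = q i) \<and> (\<forall>i<k. \<forall>j<k. dot (2*k) (q' i) (q' j) = (if i = j then 1 else 0) \<and>
     dot (2*k) (q' i) (Jmul (q' j)) = 0)"
  using assms
proof (induction "card ({..<k} - I)" arbitrary: I q)
  case 0
  then have "I = {..<k}" by auto
  with 0 show ?case by (intro exI[of _ q]) auto
next
  case (Suc d)
  then obtain l where l: "l < k" "l \<notin> I"
    by (metis Diff_iff card.empty equals0I lessThan_iff nat.distinct(1))
  have cI: "card I < k" using Suc.prems(1,2) l by (metis card_lessThan lessThan_iff finite_lessThan psubset_card_mono psubsetI)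
  obtain L where L: "set L = I" "length L = card I" using Suc.prems(1) by (metis finite_distinct_list distinct_card)
  obtain v0 where v0: "dot (2*k) v0 v0 \<noteq> 0"
    "\<forall>u\<in>set (map q L @ map (\<lambda>i. Jmul (q i)) L). dot (2*k) u v0 = 0"
    using exists_orthogonal_vector[of "map q L @ map (\<lambda>i. Jmul (q i)) L" "2*k"] cI L by auto
  define v where "v = (\<lambda>i. 1 / sqrt (dot (2*k) v0 v0) * v0 i)"
  have v1: "dot (2*k) v v = 1" unfolding v_def by (rule unit_vector[OF v0(1)])
  have v2: "dot (2*k) (q i) v = 0" "dot (2*k) v (q i) = 0" "dot (2*k) (q i) (Jmul v) = 0" "dot (2*k) v (Jmul (q i)) = 0"
    if "i \<in> I" for i
  proof -
    have "dot (2*k) (q i) v0 = 0" "dot (2*k) (Jmul (q i)) v0 = 0" using v0(2) that L by auto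
    then show a: "dot (2*k) (q i) v = 0" and "dot (2*k) v (Jmul (q i)) = 0"
      unfolding v_def dot_linear by (auto simp: dot_commute)
    then show "dot (2*k) v (q i) = 0" "dot (2*k) (q i) (Jmul v) = 0"
      using dot_Jmul_commute[of k "q i" v] dot_commute[of "2*k" v "q i"] by auto
  qed
  have "\<exists>q'. (\<forall>i\<in>insert l I. q' i = (q(l := v)) i) \<and> (\<forall>i<k. \<forall>j<k. dot (2*k) (q' i) (q' j) = (if i = j then 1 else 0) \<and>
     dot (2*k) (q' i) (Jmul (q' j)) = 0)"
  proof (rule Suc.hyps(1))
    have "{..<k} - insert l I = ({..<k} - I) - {l}" by auto
    then show "d = card ({..<k} - insert l I)" using Suc.hyps(2) l by simp
    show "finite (insert l I)" "insert l I \<subseteq> {..<k}" using Suc.prems l by auto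
    show "dot (2*k) ((q(l := v)) i) ((q(l := v)) j) = (if i = j then 1 else 0)"
      if "i \<in> insert l I" "j \<in> insert l I" for i j
      using that Suc.prems(3) v1 v2 l by auto
    show "dot (2*k) ((q(l := v)) i) (Jmul ((q(l := v)) j)) = 0"
      if "i \<in> insert l I" "j \<in> insert l I" for i j
      using that Suc.prems(4) v1 v2 l dot_Jmul_self by auto
  qed
  then obtain q' where q': "\<forall>i\<in>insert l I. q' i = (q(l := v)) i"
    "\<forall>i<k. \<forall>j<k. dot (2*k) (q' i) (q' j) = (if i = j then 1 else 0) \<and> dot (2*k) (q' i) (Jmul (q' j)) = 0" by blast
  have "\<forall>i\<in>I. q' i = q i" using q'(1) l by auto
  with q'(2) show ?case by blast
qed

text \<open>With J the action of Omega, the modes come from q i = (e i + J (f i)) / (2 sqrt (G i)) and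
  q (N + i) = (e i - J (f i)) / (2 sqrt (G i - 1)), where G i = (\<nu> i + 1) / 2. If G i = 1 then
  e i = J (f i), and q (N + i) may be any vector completing the unitary family.\<close>

lemma two_mode_squeezing_normal_form:
  fixes e f :: "nat \<Rightarrow> nat \<Rightarrow> real" and \<nu> :: "nat \<Rightarrow> real"
  assumes "2*N \<le> k"
    and ee: "\<And>i j. i < N \<Longrightarrow> j < N \<Longrightarrow> dot (2*k) (e i) (e j) = (if i = j then \<nu> i else 0)"
    and ff: "\<And>i j. i < N \<Longrightarrow> j < N \<Longrightarrow> dot (2*k) (f i) (f j) = (if i = j then \<nu> i else 0)"
    and ef: "\<And>i j. i < N \<Longrightarrow> j < N \<Longrightarrow> dot (2*k) (e i) (f j) = 0"
    and eJf: "\<And>i j. i < N \<Longrightarrow> j < N \<Longrightarrow> dot (2*k) (e i) (Jmul (f j)) = (if i = j then 1 else 0)"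
    and eJe: "\<And>i j. i < N \<Longrightarrow> j < N \<Longrightarrow> dot (2*k) (e i) (Jmul (e j)) = 0"
    and fJf: "\<And>i j. i < N \<Longrightarrow> j < N \<Longrightarrow> dot (2*k) (f i) (Jmul (f j)) = 0"
  obtains G q where "\<forall>i<N. 1 \<le> G i"
    "\<forall>i<k. \<forall>j<k. dot (2*k) (q i) (q j) = (if i = j then 1 else 0)"
    "\<forall>i<k. \<forall>j<k. dot (2*k) (q i) (Jmul (q j)) = 0"
    "\<forall>i<N. \<forall>l<2*k. sqrt (G i) * q i l + sqrt (G i - 1) * q (N + i) l = e i l"
    "\<forall>i<N. \<forall>l<2*k. sqrt (G i) * q i l - sqrt (G i - 1) * q (N + i) l = Jmul (f i) l"
proof -
  define n where "n = 2*k"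
  note A = ee[folded n_def] ff[folded n_def] ef[folded n_def] eJf[folded n_def] eJe[folded n_def] fJf[folded n_def]
  have JJ: "dot n (Jmul x) (Jmul y) = dot n x y" and Jl: "dot n (Jmul x) y = - dot n x (Jmul y)"
    and Jc: "dot n x (Jmul y) = - dot n y (Jmul x)" for x y
    unfolding n_def by (rule dot_Jmul_Jmul dot_Jmul_left dot_Jmul_commute)+
  have fe: "dot n (f i) (e j) = 0" "dot n (f i) (Jmul (e j)) = (if i = j then - 1 else 0)" if "i < N" "j < N" for i j
    using A(3)[of j i] A(4)[of j i] that Jc[of "f i" "e j"] dot_commute[of n "f i" "e j"] by auto
  \<comment> \<open>A data column of a squeezing encoding has squared length G + (G - 1), which has
    to equal \<nu> i.\<close>
  define G where "G i = (\<nu> i + 1) / 2" for i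
  define P R where "P i = (\<lambda>l. e i l + Jmul (f i) l)" and "R i = (\<lambda>l. e i l - Jmul (f i) l)" for i
  note B = P_def R_def Jmul_linear Jmul_Jmul dot_linear JJ Jl A fe
  have PP: "dot n (P i) (P j) = (if i = j then 4 * G i else 0)"
    and RR: "dot n (R i) (R j) = (if i = j then 4 * (G i - 1) else 0)"
    and PR: "dot n (P i) (R j) = 0" and RP: "dot n (R i) (P j) = 0"
    and PJ: "dot n (P i) (Jmul (P j)) = 0" "dot n (R i) (Jmul (R j)) = 0" "dot n (P i) (Jmul (R j)) = 0" "dot n (R i) (Jmul (P j)) = 0"
    if "i < N" "j < N" for i j
    using that by (simp_all add: B) (auto simp: G_def field_simps)
  \<comment> \<open>4 * (G i - 1) is the squared length of \<open>R i\<close>; this is the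
    uncertainty relation \<nu> i \<ge> 1.\<close>
  have G1: "1 \<le> G i" if "i < N" for i
    using RR[OF that that] dot_nonneg[of n "R i"] by simp
  define I where "I = {..<N} \<union> {i. N \<le> i \<and> i < 2*N \<and> G (i - N) > 1}"
  define q0 where "q0 i = (if i < N then (\<lambda>l. 1 / (2 * sqrt (G i)) * P i l)
     else (\<lambda>l. 1 / (2 * sqrt (G (i - N) - 1)) * R (i - N) l))" for i
  have "\<exists>q'. (\<forall>i\<in>I. q' i = q0 i) \<and> (\<forall>i<k. \<forall>j<k. dot (2*k) (q' i) (q' j) = (if i = j then 1 else 0) \<and>
     dot (2*k) (q' i) (Jmul (q' j)) = 0)"
  proof (rule unitary_completion)
    show "finite I" "I \<subseteq> {..<k}" using assms(1) by (auto simp: I_def)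
    fix i j assume ij: "i \<in> I" "j \<in> I"
    show "dot (2*k) (q0 i) (q0 j) = (if i = j then 1 else 0)"
    proof (cases "i < N"; cases "j < N")
      assume "i < N" "j < N"
      moreover have "sqrt (G i) * sqrt (G i) = G i" "G i > 0" using G1[OF \<open>i < N\<close>] by auto
      ultimately show ?thesis
        by (simp only: n_def[symmetric] q0_def if_True dot_linear PP) (auto simp: field_simps)
    next
      assume a: "\<not> i < N" "\<not> j < N"
      then have "i - N < N" "j - N < N" "G (i - N) > 1" "i - N = j - N \<longleftrightarrow> i = j"
        using ij by (auto simp: I_def)
      moreover from this have "sqrt (G (i - N) - 1) * sqrt (G (i - N) - 1) = G (i - N) - 1" by simp
      ultimately show ?thesis using a
        by (simp only: n_def[symmetric] q0_def if_False dot_linear RR) (auto simp: field_simps)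
    next
      assume a: "i < N" "\<not> j < N"
      then have "j - N < N" using ij by (auto simp: I_def)
      then show ?thesis using a
        by (simp only: n_def[symmetric] q0_def if_False if_True dot_linear PR) auto
    next
      assume a: "\<not> i < N" "j < N"
      then have "i - N < N" using ij by (auto simp: I_def)
      then show ?thesis using a
        by (simp only: n_def[symmetric] q0_def if_False if_True dot_linear RP) auto
    qed
    have "i < N \<or> i - N < N" "j < N \<or> j - N < N" using ij by (auto simp: I_def)
    then have "dot n (if i < N then P i else R (i - N)) (Jmul (if j < N then P j else R (j - N))) = 0"
      by (auto simp: PJ)
    moreover have "q0 i = (\<lambda>l. (if i < N then 1 / (2 * sqrt (G i)) else 1 / (2 * sqrt (G (i - N) - 1))) *
        (if i < N then P i else R (i - N)) l)" for i
      by (simp add: q0_def)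
    ultimately show "dot (2*k) (q0 i) (Jmul (q0 j)) = 0"
      by (simp only: n_def[symmetric] Jmul_linear dot_linear mult_zero_right)
  qed
  then obtain q where q: "\<forall>i\<in>I. q i = q0 i" "\<forall>i<k. \<forall>j<k. dot (2*k) (q i) (q j) = (if i = j then 1 else 0)"
     "\<forall>i<k. \<forall>j<k. dot (2*k) (q i) (Jmul (q j)) = 0" by blast
  have q1: "sqrt (G i) * q i l = P i l / 2" if "i < N" for i l
  proof -
    have "q i = q0 i" using q(1) that by (simp add: I_def)
    moreover have "sqrt (G i) > 0" using G1[OF that] by simp
    ultimately show ?thesis using that by (simp add: q0_def field_simps)
  qed
  have q2: "sqrt (G i - 1) * q (N + i) l = R i l / 2" if "i < N" "l < 2*k" for i l
  proof (cases "G i > 1")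
    case True
    then have "q (N + i) = q0 (N + i)" using q(1) that by (simp add: I_def)
    moreover have "sqrt (G i - 1) > 0" using True by simp
    ultimately show ?thesis using that by (simp add: q0_def field_simps)
  next
    case False
    then have "G i = 1" using G1[OF that(1)] by simp
    moreover from this have "R i l = 0"
      using RR[OF that(1) that(1)] that(2) by (simp add: dot_self_eq_0 n_def)
    ultimately show ?thesis by simp
  qed
  show ?thesis
  proof (rule that[OF _ q(2,3)])
    show "\<forall>i<N. 1 \<le> G i" using G1 by blast
    show "\<forall>i<N. \<forall>l<2*k. sqrt (G i) * q i l + sqrt (G i - 1) * q (N + i) l = e i l"
      "\<forall>i<N. \<forall>l<2*k. sqrt (G i) * q i l - sqrt (G i - 1) * q (N + i) l = Jmul (f i) l"
      by (auto simp: q1 q2) (auto simp: P_def R_def field_simps)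
  qed
qed

section \<open>Symplectic matrices\<close>

lemma Omega_carrier [simp]: "Omega n \<in> carrier_mat (2*n) (2*n)"
  and Omega_dim [simp]: "dim_row (Omega n) = 2*n" "dim_col (Omega n) = 2*n"
  by (simp_all add: Omega_def)

lemma Omega_sum: "i < 2*n \<Longrightarrow> (\<Sum>l<2*n. Omega n $$ (i,l) * x l) = Jmul x i"
proof -
  assume i: "i < 2*n"
  show ?thesis
  proof (cases "even i")
    case True
    then have "Suc i < 2*n" using i by (metis Suc_lessI dvd_triv_left even_Suc)
    moreover have "(\<Sum>l<2*n. Omega n $$ (i,l) * x l) = (\<Sum>l<2*n. if l = Suc i then x l else 0)"
      using True i by (intro sum.cong) (auto simp: Omega_def)
    ultimately show ?thesis using True by (simp add: Jmul_def)
  next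
    case False
    have "(\<Sum>l<2*n. Omega n $$ (i,l) * x l) = (\<Sum>l<2*n. if l = i - 1 then - x l else 0)"
      using False i by (intro sum.cong) (auto simp: Omega_def elim: oddE)
    then show ?thesis using False i by (simp add: Jmul_def)
  qed
qed

lemma Omega_mult_entry:
  "X \<in> carrier_mat (2*n) m \<Longrightarrow> i < 2*n \<Longrightarrow> j < m \<Longrightarrow> (Omega n * X) $$ (i,j) = Jmul (\<lambda>l. X $$ (l,j)) i"
  using Omega_sum[of i n "\<lambda>l. X $$ (l,j)"]
  by (simp add: scalar_prod_def lessThan_atLeast0 row_def col_def)

text \<open>The bridge from matrix identities to the calculus of \<open>dot\<close> and
  \<open>Jmul\<close> on columns.\<close>

lemma sandwich_entry:
  assumes "X \<in> carrier_mat (2*n) m" "Y \<in> carrier_mat (2*n) m'" "i < m" "j < m'"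
  shows "(transpose_mat X * Omega n * Y) $$ (i,j) = dot (2*n) (\<lambda>l. X $$ (l,i)) (Jmul (\<lambda>l. Y $$ (l,j)))"
proof -
  have "transpose_mat X * Omega n * Y = transpose_mat X * (Omega n * Y)"
    using assms by (intro assoc_mult_mat[of _ m "2*n" _ "2*n" _ m']) auto
  also have "\<dots> $$ (i,j) = (\<Sum>l<2*n. X $$ (l,i) * (Omega n * Y) $$ (l,j))"
    using assms by (simp add: scalar_prod_def lessThan_atLeast0 row_def col_def)
  also have "\<dots> = dot (2*n) (\<lambda>l. X $$ (l,i)) (Jmul (\<lambda>l. Y $$ (l,j)))"
    using assms Omega_mult_entry[OF assms(2) _ assms(4)] by (simp add: dot_def)
  finally show ?thesis .
qed

lemma Omega_Omega: "Omega n * Omega n = - 1\<^sub>m (2*n)"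
proof (rule eq_matI)
  fix i j assume ij: "i < dim_row (- 1\<^sub>m (2*n) :: real mat)" "j < dim_col (- 1\<^sub>m (2*n) :: real mat)"
  then have "(Omega n * Omega n) $$ (i,j) = Jmul (\<lambda>l. Omega n $$ (l,j)) i"
    by (intro Omega_mult_entry) auto
  also have "\<dots> = (- 1\<^sub>m (2*n)) $$ (i,j)"
  proof (cases "even i")
    case True
    then have "Suc i < 2*n" using ij by (metis Suc_lessI dvd_triv_left even_Suc index_one_mat(2) index_uminus_mat(2))
    then show ?thesis using True ij by (auto simp: Jmul_def Omega_def)
  next
    case False
    then show ?thesis using ij by (auto simp: Jmul_def Omega_def elim!: oddE)
  qed
  finally show "(Omega n * Omega n) $$ (i,j) = (- 1\<^sub>m (2*n)) $$ (i,j)" .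
qed auto

section \<open>Inverses and the group of symplectic matrices\<close>

lemma symplectic_carrier: "symplectic n A \<Longrightarrow> A \<in> carrier_mat (2*n) (2*n)"
  by (simp add: symplectic_def)

text \<open>The inverse of a symplectic A, from A Omega A^T = Omega and Omega^2 = -1. The explicit
  formula replaces the choice in \<open>inv_mat\<close> and expresses X^-1 S through the symplectic
  products of the columns of X and S.\<close>

definition sinv :: "nat \<Rightarrow> real mat \<Rightarrow> real mat" where
  "sinv n A = - (Omega n * transpose_mat A * Omega n)"

lemma sinv_carrier: "A \<in> carrier_mat (2*n) (2*n) \<Longrightarrow> sinv n A \<in> carrier_mat (2*n) (2*n)"
  unfolding sinv_def by (intro uminus_carrier_iff_mat[THEN iffD2] mult_carrier_mat[of _ _ "2*n"]) auto

lemma mult_sinv: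
  assumes "symplectic n A" shows "A * sinv n A = 1\<^sub>m (2*n)" "sinv n A * A = 1\<^sub>m (2*n)"
proof -
  let ?d = "2*n"
  note A = symplectic_carrier[OF assms]
  have "A * (Omega n * transpose_mat A * Omega n) = A * (Omega n * transpose_mat A) * Omega n"
    using A by (intro assoc_mult_mat[symmetric, of _ ?d ?d _ ?d _ ?d]) auto
  also have "A * (Omega n * transpose_mat A) = A * Omega n * transpose_mat A"
    using A by (intro assoc_mult_mat[symmetric, of _ ?d ?d _ ?d _ ?d]) auto
  also have "\<dots> = Omega n" using assms by (simp add: symplectic_def)
  finally have "A * (Omega n * transpose_mat A * Omega n) = - 1\<^sub>m ?d" by (simp add: Omega_Omega)
  then show "A * sinv n A = 1\<^sub>m ?d"
    using A unfolding sinv_def by simp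
  then show "sinv n A * A = 1\<^sub>m ?d"
    using mat_mult_left_right_inverse[OF A sinv_carrier[OF A]] by simp
qed

text \<open>A right inverse of a square matrix is a left inverse; \<open>sinv n A * A = 1\<close>
  reads -Omega (A^T Omega A) = 1, and another factor Omega frees the bracket.\<close>

lemma symplectic_transposeD:
  assumes "symplectic n A" shows "transpose_mat A * Omega n * A = Omega n"
proof -
  let ?d = "2*n"
  note A = symplectic_carrier[OF assms]
  let ?Y = "transpose_mat A * Omega n * A"
  have Y: "?Y \<in> carrier_mat ?d ?d" using A by auto
  have "Omega n * transpose_mat A * Omega n * A = Omega n * ?Y"
  proof -
    have "Omega n * transpose_mat A * Omega n * A = Omega n * transpose_mat A * (Omega n * A)"
      using A by (intro assoc_mult_mat[of _ ?d ?d _ ?d _ ?d]) auto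
    also have "\<dots> = Omega n * (transpose_mat A * (Omega n * A))"
      using A by (intro assoc_mult_mat[of _ ?d ?d _ ?d _ ?d]) auto
    also have "transpose_mat A * (Omega n * A) = ?Y"
      using A by (intro assoc_mult_mat[symmetric, of _ ?d ?d _ ?d _ ?d]) auto
    finally show ?thesis .
  qed
  moreover have "- (Omega n * transpose_mat A * Omega n) * A = 1\<^sub>m ?d"
    using mult_sinv(2)[OF assms] by (simp add: sinv_def)
  moreover have "- (Omega n * transpose_mat A * Omega n) * A = - (Omega n * transpose_mat A * Omega n * A)"
    using A by simp
  ultimately have "- (Omega n * ?Y) = 1\<^sub>m ?d" by simp
  then have "Omega n * ?Y = - 1\<^sub>m ?d" by (metis uminus_uminus_mat)
  then have "Omega n * (Omega n * ?Y) = Omega n * - 1\<^sub>m ?d" by simp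
  moreover have "Omega n * (Omega n * ?Y) = - 1\<^sub>m ?d * ?Y"
    using Y by (subst assoc_mult_mat[symmetric, of _ ?d ?d _ ?d _ ?d]) (auto simp: Omega_Omega)
  moreover have "- 1\<^sub>m ?d * ?Y = - (1\<^sub>m ?d * ?Y)" using A by (intro uminus_mult_left_mat) auto
  moreover have "1\<^sub>m ?d * ?Y = ?Y" using Y by (rule left_mult_one_mat)
  moreover have "Omega n * - 1\<^sub>m ?d = - Omega n" by (simp add: right_mult_one_mat[of _ "2*n"])
  ultimately have "- ?Y = - Omega n" by metis
  then show ?thesis by (metis uminus_uminus_mat)
qed

lemma symplecticI_transpose:
  assumes A: "A \<in> carrier_mat (2*n) (2*n)" and t: "transpose_mat A * Omega n * A = Omega n"
  shows "symplectic n A"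
proof -
  have "symplectic n (transpose_mat A)" using A t by (simp add: symplectic_def)
  from symplectic_transposeD[OF this] show ?thesis using A by (simp add: symplectic_def)
qed

lemma transpose_sandwich_mult:
  fixes A B X :: "real mat"
  assumes A: "A \<in> carrier_mat n n" and B: "B \<in> carrier_mat n n" and X: "X \<in> carrier_mat n n"
  shows "transpose_mat (A * B) * X * (A * B) = transpose_mat B * (transpose_mat A * X * A) * B"
proof -
  have At: "transpose_mat A \<in> carrier_mat n n" and Bt: "transpose_mat B \<in> carrier_mat n n" using A B by auto
  note c = mult_carrier_mat[of _ n n _ n]
  have "transpose_mat (A * B) * X * (A * B) = transpose_mat B * transpose_mat A * X * A * B"
    using assoc_mult_mat[OF c[OF c[OF Bt At] X] A B] transpose_mult[OF A B] by simp
  also have "transpose_mat B * transpose_mat A * X = transpose_mat B * (transpose_mat A * X)"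
    by (rule assoc_mult_mat[OF Bt At X])
  also have "\<dots> * A = transpose_mat B * (transpose_mat A * X * A)"
    by (rule assoc_mult_mat[OF Bt c[OF At X] A])
  finally show ?thesis .
qed

lemma symplectic_mult:
  assumes "symplectic n A" "symplectic n B" shows "symplectic n (A * B)"
proof (rule symplecticI_transpose)
  note A = symplectic_carrier[OF assms(1)] and B = symplectic_carrier[OF assms(2)]
  show "A * B \<in> carrier_mat (2*n) (2*n)" using A B by (rule mult_carrier_mat)
  show "transpose_mat (A * B) * Omega n * (A * B) = Omega n"
    unfolding transpose_sandwich_mult[OF A B Omega_carrier] symplectic_transposeD[OF assms(1)]
    by (rule symplectic_transposeD[OF assms(2)])
qed

lemma symplectic_sinv:
  assumes "symplectic n A" shows "symplectic n (sinv n A)"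
proof (rule symplecticI_transpose)
  let ?B = "sinv n A"
  note A = symplectic_carrier[OF assms]
  note B = sinv_carrier[OF A]
  show "?B \<in> carrier_mat (2*n) (2*n)" by (rule B)
  have "transpose_mat ?B * Omega n * ?B = transpose_mat ?B * (transpose_mat A * Omega n * A) * ?B"
    by (simp add: symplectic_transposeD[OF assms])
  also have "\<dots> = transpose_mat (A * ?B) * Omega n * (A * ?B)"
    by (rule transpose_sandwich_mult[OF A B Omega_carrier, symmetric])
  finally show "transpose_mat ?B * Omega n * ?B = Omega n" using mult_sinv(1)[OF assms] by simp
qed

lemma inv_mat_eq:
  assumes "A \<in> carrier_mat n n" "B \<in> carrier_mat n n" "A * B = 1\<^sub>m n"
  shows "inv_mat n A = B"
  unfolding inv_mat_def
proof (rule some_equality)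
  have BA: "B * A = 1\<^sub>m n" using assms by (rule mat_mult_left_right_inverse)
  then show "B \<in> carrier_mat n n \<and> A * B = 1\<^sub>m n \<and> B * A = 1\<^sub>m n" using assms by simp
  fix C assume C: "C \<in> carrier_mat n n \<and> A * C = 1\<^sub>m n \<and> C * A = 1\<^sub>m n"
  then have "C = B * A * C" using BA left_mult_one_mat[of C n n] by simp
  also have "\<dots> = B * (A * C)" using assms C by (intro assoc_mult_mat) auto
  finally show "C = B" using assms C by simp
qed

text \<open>Take determinants in A Omega A^T = Omega and cancel det Omega, which is nonzero because
  Omega times -Omega is 1. The factor (det A)^2 is the one that A V A^T picks up.\<close>

lemma det_symplectic_square:
  assumes "symplectic n A" shows "(det A)\<^sup>2 = 1"
proof -
  note A = symplectic_carrier[OF assms]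
  have "det (Omega n) * det (- Omega n) = det (Omega n * - Omega n)"
    by (rule det_mult[symmetric, of _ "2*n"]) auto
  also have "\<dots> = 1" by (simp add: Omega_Omega)
  finally have "det (Omega n) \<noteq> 0" by auto
  moreover have "det (A * Omega n * transpose_mat A) = det A * det (Omega n) * det A"
    using A by (simp add: det_mult[of _ "2*n"] det_transpose)
  ultimately show ?thesis using assms by (simp add: symplectic_def power2_eq_square)
qed

section \<open>Block structure with respect to data and ancilla modes\<close>

lemma Omega_four_block: "Omega (N + M) = four_block_mat (Omega N) (0\<^sub>m (2*N) (2*M)) (0\<^sub>m (2*M) (2*N)) (Omega M)"
  by (rule eq_matI) (auto simp: Omega_def, presburger+)

text \<open>For the triangular matrix P the upper right block of P Omega P^T is A Omega C^T, which
  must be 0. The upper left block shows that A is symplectic, hence invertible, so C = 0; the lower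
  right block then reduces to the condition on D.\<close>

lemma symplectic_block_triangular:
  assumes A: "A \<in> carrier_mat (2*N) (2*N)" and C: "C \<in> carrier_mat (2*M) (2*N)" and D: "D \<in> carrier_mat (2*M) (2*M)"
    and S: "symplectic (N+M) (four_block_mat A (0\<^sub>m (2*N) (2*M)) C D)"
  shows "symplectic N A" "C = 0\<^sub>m (2*M) (2*N)" "symplectic M D"
proof -
  let ?n = "2*N" and ?m = "2*M"
  let ?P = "four_block_mat A (0\<^sub>m ?n ?m) C D"
  let ?O = "Omega N" and ?O' = "Omega M"
  have 1: "?P * Omega (N+M) = four_block_mat (A * ?O) (0\<^sub>m ?n ?m) (C * ?O) (D * ?O')"
    unfolding Omega_four_block using A C D
    by (subst mult_four_block_mat[of _ ?n ?n _ ?m _ ?m _ _ ?n _ ?m]) auto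
  have 2: "transpose_mat ?P = four_block_mat (transpose_mat A) (transpose_mat C) (0\<^sub>m ?m ?n) (transpose_mat D)"
    using A C D by (subst transpose_four_block_mat[of _ ?n ?n _ ?m _ ?m]) auto
  have 3: "?P * Omega (N+M) * transpose_mat ?P = four_block_mat (A * ?O * transpose_mat A) (A * ?O * transpose_mat C)
     (C * ?O * transpose_mat A) (C * ?O * transpose_mat C + D * ?O' * transpose_mat D)"
    unfolding 1 2 using A C D
    by (subst mult_four_block_mat[of _ ?n ?n _ ?m _ ?m _ _ ?n _ ?m]) auto
  have eq: "four_block_mat (A * ?O * transpose_mat A) (A * ?O * transpose_mat C)
     (C * ?O * transpose_mat A) (C * ?O * transpose_mat C + D * ?O' * transpose_mat D)
     = four_block_mat ?O (0\<^sub>m ?n ?m) (0\<^sub>m ?m ?n) ?O'"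
    using S 3 unfolding symplectic_def Omega_four_block by simp
  have inj: "A1 = B1 \<and> A2 = B2 \<and> A4 = B4" if "four_block_mat A1 A2 A3 A4 = four_block_mat B1 B2 B3 B4"
    "A1 \<in> carrier_mat ?n ?n" "A2 \<in> carrier_mat ?n ?m" "A3 \<in> carrier_mat ?m ?n" "A4 \<in> carrier_mat ?m ?m"
    "B1 \<in> carrier_mat ?n ?n" "B2 \<in> carrier_mat ?n ?m" "B3 \<in> carrier_mat ?m ?n" "B4 \<in> carrier_mat ?m ?m"
    for A1 A2 A3 A4 B1 B2 B3 B4 :: "real mat"
  proof -
    have e: "four_block_mat A1 A2 A3 A4 $$ (i,j) = four_block_mat B1 B2 B3 B4 $$ (i,j)" for i j using that(1) by simp
    have "A1 $$ (i,j) = B1 $$ (i,j)" if "i < ?n" "j < ?n" for i j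
      using e[of i j] that \<open>A1 \<in> _\<close> \<open>A4 \<in> _\<close> \<open>B1 \<in> _\<close> \<open>B4 \<in> _\<close> by auto
    moreover have "A2 $$ (i,j) = B2 $$ (i,j)" if "i < ?n" "j < ?m" for i j
      using e[of i "?n + j"] that \<open>A1 \<in> _\<close> \<open>A4 \<in> _\<close> \<open>B1 \<in> _\<close> \<open>B4 \<in> _\<close> by auto
    moreover have "A4 $$ (i,j) = B4 $$ (i,j)" if "i < ?m" "j < ?m" for i j
      using e[of "?n + i" "?n + j"] that \<open>A1 \<in> _\<close> \<open>A4 \<in> _\<close> \<open>B1 \<in> _\<close> \<open>B4 \<in> _\<close> by auto
    ultimately show ?thesis using that by (auto intro!: eq_matI)
  qed
  have e: "A * ?O * transpose_mat A = ?O" "A * ?O * transpose_mat C = 0\<^sub>m ?n ?m"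
    "C * ?O * transpose_mat C + D * ?O' * transpose_mat D = ?O'"
    using inj[OF eq] A C D by auto
  then show sA: "symplectic N A" using A by (simp add: symplectic_def)
  have "sinv N A * (A * (?O * transpose_mat C)) = sinv N A * A * (?O * transpose_mat C)"
    using A C sinv_carrier[OF A] by (intro assoc_mult_mat[symmetric, of _ ?n ?n _ ?n _ ?m]) auto
  also have "\<dots> = ?O * transpose_mat C" using mult_sinv(2)[OF sA] C by simp
  also have "A * (?O * transpose_mat C) = 0\<^sub>m ?n ?m"
    using e(2) A C by (simp add: assoc_mult_mat[of _ ?n ?n _ ?n _ ?m])
  finally have "?O * transpose_mat C = 0\<^sub>m ?n ?m" using sinv_carrier[OF A] by simp
  then have "?O * (?O * transpose_mat C) = 0\<^sub>m ?n ?m" by simp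
  moreover have "?O * (?O * transpose_mat C) = - transpose_mat C"
    using C by (subst assoc_mult_mat[symmetric, of _ ?n ?n _ ?n _ ?m]) (auto simp: Omega_Omega)
  ultimately have Ct: "- transpose_mat C = 0\<^sub>m ?n ?m" by simp
  show C0: "C = 0\<^sub>m ?m ?n"
  proof (rule eq_matI)
    fix i j assume "i < dim_row (0\<^sub>m ?m ?n :: real mat)" "j < dim_col (0\<^sub>m ?m ?n :: real mat)"
    then show "C $$ (i,j) = 0\<^sub>m ?m ?n $$ (i,j)" using arg_cong[OF Ct, of "\<lambda>X. X $$ (j,i)"] C by auto
  qed (use C in auto)
  have "0\<^sub>m ?m ?m + D * ?O' * transpose_mat D = D * ?O' * transpose_mat D"
    using D by (intro left_add_zero_mat) auto
  then show "symplectic M D" using e(3) D unfolding C0 symplectic_def by simp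
qed

section \<open>Two-mode squeezing encodings\<close>

lemma tms_enc_carrier [simp]: "tms_enc N M G \<in> carrier_mat (2*(N+M)) (2*(N+M))"
  and tms_enc_dim [simp]: "dim_row (tms_enc N M G) = 2*(N+M)" "dim_col (tms_enc N M G) = 2*(N+M)"
  by (simp_all add: tms_enc_def)

definition tms_diag :: "nat \<Rightarrow> (nat \<Rightarrow> real) \<Rightarrow> nat \<Rightarrow> real" where
  "tms_diag N G j = (if j < 2*N then sqrt (G (j div 2)) else if j < 4*N then sqrt (G (j div 2 - N)) else 1)"

definition tms_offdiag :: "nat \<Rightarrow> (nat \<Rightarrow> real) \<Rightarrow> nat \<Rightarrow> real" where
  "tms_offdiag N G j = (if even j then 1 else -1) *
     (if j < 2*N then sqrt (G (j div 2) - 1) else if j < 4*N then sqrt (G (j div 2 - N) - 1) else 0)"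

text \<open>A shift by N modes is a shift by 2*N coordinates. For unsqueezed ancilla modes, j \<ge>
  4*N, the value is a placeholder that stays in range; \<open>tms_offdiag\<close> is 0
  there.\<close>

definition partner :: "nat \<Rightarrow> nat \<Rightarrow> nat" where
  "partner N j = (if j < 2*N then j + 2*N else j - 2*N)"

text \<open>Each column is a sum of two multiples of coordinate vectors. The proof writes a
  coordinate as 2 * mode + quadrature; the partner keeps the quadrature and shifts the mode by
  N.\<close>

lemma tms_enc_entry:
  assumes "l < 2*(N+M)" "j < 2*(N+M)" "N \<ge> 1"
  shows "tms_enc N M G $$ (l,j) = (if l = j then tms_diag N G j else 0) + (if l = partner N j then tms_offdiag N G j else 0)"
proof -
  obtain a x where l: "l = 2*a + x" "x < 2" using mod_less_divisor[of 2 l] by (metis mult_div_mod_eq pos2)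
  obtain b y where j: "j = 2*b + y" "y < 2" using mod_less_divisor[of 2 j] by (metis mult_div_mod_eq pos2)
  have jN: "j < 2*N \<longleftrightarrow> b < N" "j < 4*N \<longleftrightarrow> b < 2*N" using l j by auto
  have lp: "l = partner N j \<longleftrightarrow> x = y \<and> (if b < N then a = b + N else b = a + N)"
  proof (cases "b < N")
    case True
    then have "l = partner N j \<longleftrightarrow> 2*a + x = 2*(b + N) + y" using l(1) j(1) jN by (auto simp: partner_def)
    also have "\<dots> \<longleftrightarrow> x = y \<and> a = b + N" using l(2) j(2) by presburger
    finally show ?thesis using True by simp
  next
    case False
    then have "l = partner N j \<longleftrightarrow> 2*(a + N) + x = 2*b + y" using l(1) j(1) jN by (auto simp: partner_def)
    also have "\<dots> \<longleftrightarrow> x = y \<and> b = a + N" using l(2) j(2) by presburger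
    finally show ?thesis using False by simp
  qed
  have dm: "l div 2 = a" "l mod 2 = x" "j div 2 = b" "j mod 2 = y" using l j by auto
  have ev: "even l \<longleftrightarrow> x = 0" "even j \<longleftrightarrow> y = 0" using l j by auto
  have T: "tms_enc N M G $$ (l,j) =
     (if x \<noteq> y then 0
     else if a = b then (if a < N then sqrt (G a) else if a < 2*N then sqrt (G (a - N)) else 1)
     else if a < N \<and> b = N + a then (if x = 0 then 1 else -1) * sqrt (G a - 1)
     else if b < N \<and> a = N + b then (if x = 0 then 1 else -1) * sqrt (G b - 1)
     else 0)"
    using assms(1,2) by (simp add: tms_enc_def Let_def dm ev)
  have lj: "l = j \<longleftrightarrow> a = b \<and> x = y" using l(1) j(1) dm by metis
  show ?thesis
    unfolding T lj lp tms_diag_def tms_offdiag_def jN dm ev using assms(3) by (cases "x = y"; cases "b < N") auto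
qed

lemma partner_lt: "N \<le> M \<Longrightarrow> j < 2*(N+M) \<Longrightarrow> partner N j < 2*(N+M)"
  by (auto simp: partner_def)

text \<open>By bilinearity, the symplectic product of two columns of the encoding becomes four terms
  of this shape.\<close>

lemma dot_delta:
  assumes "a < 2*n" "b < 2*n"
  shows "dot (2*n) (\<lambda>l. if l = a then c else 0) (Jmul (\<lambda>l. if l = b then c' else 0)) = c * c' * Omega n $$ (a,b)"
proof -
  have "dot (2*n) (\<lambda>l. if l = a then c else 0) (Jmul (\<lambda>l. if l = b then c' else 0))
     = (\<Sum>l<2*n. if l = a then c * Jmul (\<lambda>l. if l = b then c' else 0) a else 0)"
    unfolding dot_def by (intro sum.cong) auto
  also have "\<dots> = c * Jmul (\<lambda>l. if l = b then c' else 0) a" using assms by simp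
  also have "\<dots> = c * c' * Omega n $$ (a,b)"
    using assms by (auto simp: Jmul_def Omega_def elim!: oddE)
  finally show ?thesis .
qed

lemma symplectic_tms_enc:
  assumes "1 \<le> N" "N \<le> M" and G: "\<forall>i<N. 1 \<le> G i"
  shows "symplectic (N+M) (tms_enc N M G)"
proof (rule symplecticI_transpose)
  let ?K = "N + M" and ?T = "tms_enc N M G"
  show "?T \<in> carrier_mat (2*?K) (2*?K)" by (rule tms_enc_carrier)
  show "transpose_mat ?T * Omega ?K * ?T = Omega ?K"
  proof (rule eq_matI)
    fix i j assume "i < dim_row (Omega ?K)" "j < dim_col (Omega ?K)"
    then have i: "i < 2*?K" and j: "j < 2*?K" by auto
    have T: "dot (2*?K) (\<lambda>l. ?T $$ (l,i)) (Jmul (\<lambda>l. ?T $$ (l,j))) =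
      dot (2*?K) (\<lambda>l. (if l = i then tms_diag N G i else 0) + (if l = partner N i then tms_offdiag N G i else 0))
       (Jmul (\<lambda>l. (if l = j then tms_diag N G j else 0) + (if l = partner N j then tms_offdiag N G j else 0)))"
    proof (rule dot_cong)
      fix l assume l: "l < 2*?K"
      show "?T $$ (l,i) = (if l = i then tms_diag N G i else 0) + (if l = partner N i then tms_offdiag N G i else 0)"
        by (rule tms_enc_entry[OF l i assms(1)])
      have "even l \<Longrightarrow> Suc l < 2*?K" using l by presburger
      then show "Jmul (\<lambda>l. ?T $$ (l,j)) l = Jmul (\<lambda>l. (if l = j then tms_diag N G j else 0) + (if l = partner N j then tms_offdiag N G j else 0)) l"
        using l tms_enc_entry[OF _ j assms(1)] by (auto simp: Jmul_def)
    qed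
    have pi: "partner N i < 2*?K" and pj: "partner N j < 2*?K" using partner_lt assms(2) i j by blast+
    have "(transpose_mat ?T * Omega ?K * ?T) $$ (i,j) =
      tms_diag N G i * tms_diag N G j * Omega ?K $$ (i,j) + tms_diag N G i * tms_offdiag N G j * Omega ?K $$ (i, partner N j)
      + tms_offdiag N G i * tms_diag N G j * Omega ?K $$ (partner N i, j) + tms_offdiag N G i * tms_offdiag N G j * Omega ?K $$ (partner N i, partner N j)"
      using i j by (subst sandwich_entry[of _ _ "2*?K" _ "2*?K"])
        (auto simp only: tms_enc_carrier T Jmul_linear dot_linear dot_delta[OF i j] dot_delta[OF i pj] dot_delta[OF pi j] dot_delta[OF pi pj] add.assoc)
    also have "\<dots> = Omega ?K $$ (i,j)"
    proof -
      have G': "sqrt (G l) * sqrt (G l) = G l" "sqrt (G l - 1) * sqrt (G l - 1) = G l - 1" if "l < N" for l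
        using G that by (auto simp: order_trans[OF zero_le_one])
      obtain a x where ia: "i = 2*a + x" "x < 2" using mod_less_divisor[of 2 i] by (metis mult_div_mod_eq pos2)
      obtain b y where jb: "j = 2*b + y" "y < 2" using mod_less_divisor[of 2 j] by (metis mult_div_mod_eq pos2)
      have xy: "x = 0 \<or> x = 1" "y = 0 \<or> y = 1" using ia jb by auto
      have lt: "i < 2*N \<longleftrightarrow> a < N" "i < 4*N \<longleftrightarrow> a < 2*N" "j < 2*N \<longleftrightarrow> b < N" "j < 4*N \<longleftrightarrow> b < 2*N" using ia jb by auto
      define A where "A = (if a < N then a + N else a - N)"
      define B where "B = (if b < N then b + N else b - N)"
      have pAB: "partner N i = 2*A + x" "partner N j = 2*B + y"
        using ia jb by (auto simp: partner_def A_def B_def)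
      have Om: "Omega ?K $$ (2*p + u, 2*q + v) = (if p = q \<and> u = 0 \<and> v = 1 then 1 else if p = q \<and> u = 1 \<and> v = 0 then -1 else 0)"
        if "2*p + u < 2*?K" "2*q + v < 2*?K" "u = 0 \<or> u = 1" "v = 0 \<or> v = 1" for p q u v
        using that by (auto simp: Omega_def) presburger+
      have O: "Omega ?K $$ (i,j) = (if a = b \<and> x = 0 \<and> y = 1 then 1 else if a = b \<and> x = 1 \<and> y = 0 then -1 else 0)"
        "Omega ?K $$ (i,partner N j) = (if a = B \<and> x = 0 \<and> y = 1 then 1 else if a = B \<and> x = 1 \<and> y = 0 then -1 else 0)"
        "Omega ?K $$ (partner N i,j) = (if A = b \<and> x = 0 \<and> y = 1 then 1 else if A = b \<and> x = 1 \<and> y = 0 then -1 else 0)"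
        "Omega ?K $$ (partner N i,partner N j) = (if A = B \<and> x = 0 \<and> y = 1 then 1 else if A = B \<and> x = 1 \<and> y = 0 then -1 else 0)"
        using Om[OF i[unfolded ia(1)] j[unfolded jb(1)] xy] Om[OF i[unfolded ia(1)] pj[unfolded pAB] xy]
          Om[OF pi[unfolded pAB] j[unfolded jb(1)] xy] Om[OF pi[unfolded pAB] pj[unfolded pAB] xy]
        unfolding pAB ia(1)[symmetric] jb(1)[symmetric] by blast+
      define ci where "ci = (if a < N then sqrt (G a) else if a < 2*N then sqrt (G (a - N)) else 1)"
      define cj where "cj = (if b < N then sqrt (G b) else if b < 2*N then sqrt (G (b - N)) else 1)"
      define si where "si = (if a < N then sqrt (G a - 1) else if a < 2*N then sqrt (G (a - N) - 1) else 0)"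
      define sj where "sj = (if b < N then sqrt (G b - 1) else if b < 2*N then sqrt (G (b - N) - 1) else 0)"
      have c: "tms_diag N G i = ci" "tms_diag N G j = cj" unfolding tms_diag_def lt ci_def cj_def using ia jb by auto
      have s: "tms_offdiag N G i = (if x = 0 then 1 else -1) * si" "tms_offdiag N G j = (if y = 0 then 1 else -1) * sj"
        unfolding tms_offdiag_def lt si_def sj_def using ia jb xy by auto
      \<comment> \<open>Omega couples only q with p, and there the signs coming from Z are opposite.
        So the product of the off-diagonal coefficients enters with a minus sign, giving G - (G - 1)
        = 1, and the two mixed terms cancel.\<close>
      have same: "ci * cj - si * sj = 1" if "a = b"
        using that G' by (auto simp: ci_def cj_def si_def sj_def)
      \<comment> \<open>Distinct modes have the same partner index only when one of them is
        unsqueezed and carries the placeholder; its coefficient is 0.\<close>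
      have AB: "A = B \<Longrightarrow> a = b \<or> si * sj = 0" 
        by (auto simp: A_def B_def si_def sj_def split: if_splits)
      have Y: "si * sj * (if A = B then 1 else 0) = si * sj * (if a = b then 1 else 0)"
        using AB by (auto simp: A_def B_def)
      have X: "ci * sj * (if a = B then 1 else 0) = si * cj * (if A = b then 1 else 0)"
        by (auto simp: ci_def cj_def si_def sj_def A_def B_def)
      have Z: "(ci * cj - si * sj) * (if a = b then 1 else 0) = (if a = b then 1 else 0)"
        using same by simp
      have "x = y \<or> x = 0 \<and> y = 1 \<or> x = 1 \<and> y = 0" using xy by auto
      then show ?thesis
        unfolding O c s using X Y Z by (elim disjE) (auto simp: algebra_simps split: if_splits)
    qed
    finally show "(transpose_mat ?T * Omega ?K * ?T) $$ (i,j) = Omega ?K $$ (i,j)" .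
  qed auto
qed

section \<open>Factorization of a symplectic matrix through a squeezing encoding\<close>

lemma mult_entry_sum:
  "A \<in> carrier_mat m n \<Longrightarrow> B \<in> carrier_mat n p \<Longrightarrow> i < m \<Longrightarrow> j < p \<Longrightarrow> (A * B) $$ (i,j) = (\<Sum>l<n. A $$ (i,l) * B $$ (l,j))"
  by (simp add: scalar_prod_def lessThan_atLeast0 row_def col_def)

text \<open>The hypothesis says z^T S = 0, and multiplying by the inverse of S gives z = 0.\<close>

lemma symplectic_cols_nondegenerate:
  assumes "symplectic n S" "\<And>j. j < 2*n \<Longrightarrow> dot (2*n) (\<lambda>l. S $$ (l,j)) z = 0"
  shows "dot (2*n) z z = 0"
  unfolding dot_self_eq_0
proof (intro allI impI)
  fix i assume i: "i < 2*n"
  note S = symplectic_carrier[OF assms(1)]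
  note I = sinv_carrier[OF S]
  have "0 = (\<Sum>j<2*n. dot (2*n) (\<lambda>l. S $$ (l,j)) z * sinv n S $$ (j,i))" by (simp add: assms(2))
  also have "\<dots> = (\<Sum>j<2*n. \<Sum>l<2*n. z l * (S $$ (l,j) * sinv n S $$ (j,i)))"
    by (intro sum.cong refl) (simp add: dot_def sum_distrib_left mult_ac)
  also have "\<dots> = (\<Sum>l<2*n. \<Sum>j<2*n. z l * (S $$ (l,j) * sinv n S $$ (j,i)))" by (rule sum.swap)
  also have "\<dots> = (\<Sum>l<2*n. z l * (S * sinv n S) $$ (l,i))"
    using i by (simp add: mult_entry_sum[OF S I] sum_distrib_left)
  also have "\<dots> = (\<Sum>l<2*n. if l = i then z l else 0)"
    using i by (intro sum.cong) (auto simp: mult_sinv(1)[OF assms(1)])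
  also have "\<dots> = z i" using i by simp
  finally show "z i = 0" by simp
qed

theorem symplectic_tms_decomposition:
  assumes N: "1 \<le> N" and NM: "N \<le> M" and S: "symplectic (N+M) S"
  obtains G Q A D where "\<forall>i<N. 1 \<le> G i" "Q \<in> carrier_mat (2*(N+M)) (2*(N+M))"
    "transpose_mat Q * Q = 1\<^sub>m (2*(N+M))" "symplectic N A" "symplectic M D"
    "S = Q * tms_enc N M G * four_block_mat A (0\<^sub>m (2*N) (2*M)) (0\<^sub>m (2*M) (2*N)) D"
proof -
  define k where "k = N + M"
  define n where "n = 2*k"
  have S': "symplectic k S" using S by (simp add: k_def)
  note Sc = symplectic_carrier[OF S']
  define s where "s j = (\<lambda>l. S $$ (l,j))" for j
  have sS: "dot n (s i) (Jmul (s j)) = Omega k $$ (i,j)" if "i < 2*k" "j < 2*k" for i j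
    using sandwich_entry[OF Sc Sc that] symplectic_transposeD[OF S'] by (simp add: s_def n_def)
  txt \<open>The complement of us is the span of the data columns of S.\<close>
  define us where "us = map (\<lambda>l. Jmul (s (2*N + l))) [0..<2*M]"
  let ?U = "{x. \<forall>u\<in>set us. dot (2*k) x u = 0}"
  have U_iff: "x \<in> ?U \<longleftrightarrow> (\<forall>l<2*M. dot n x (Jmul (s (2*N + l))) = 0)" for x
    by (auto simp: us_def n_def)
  \<comment> \<open>J z is orthogonal to every column of S: to the data columns because they lie in
    U, to the ancilla columns because z does.\<close>
  have nd: "dot (2*k) z z = 0" if z: "z \<in> ?U" "\<And>x. x \<in> ?U \<Longrightarrow> dot (2*k) x (Jmul z) = 0" for z
  proof -
    have "dot (2*k) (\<lambda>l. S $$ (l,j)) (Jmul z) = 0" if j: "j < 2*k" for j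
    proof (cases "j < 2*N")
      case True
      have "Omega k $$ (j, 2*N + l) = 0" if "l < 2*M" for l
        using True that j by (auto simp: Omega_def k_def)
      then have "s j \<in> ?U" unfolding U_iff using j by (auto simp: sS k_def)
      then show ?thesis using z(2) by (simp add: s_def)
    next
      case False
      then have "j = 2*N + (j - 2*N)" "j - 2*N < 2*M" using j by (auto simp: k_def)
      then have "dot n z (Jmul (s j)) = 0" using z(1) unfolding U_iff by metis
      then show ?thesis using dot_Jmul_commute[of k "s j" z] by (simp add: n_def s_def)
    qed
    then have "dot (2*k) (Jmul z) (Jmul z) = 0" by (rule symplectic_cols_nondegenerate[OF S'])
    then show ?thesis by (simp add: dot_Jmul_Jmul)
  qed
  \<comment> \<open>Since 2*M + 2*N = 2*k, the dimension count leaves room for exactly N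
    planes.\<close>
  have "length us + 2*N \<le> 2*k" by (simp add: us_def k_def)
  from williamson_in_complement[OF nd this]
  obtain a c \<alpha> where W: "\<forall>i<N. \<alpha> i > 0 \<and> a i \<in> ?U \<and> c i \<in> ?U \<and>
     (\<forall>j<N. dot (2*k) (a i) (a j) = (if i = j then 1 else 0) \<and>
            dot (2*k) (c i) (c j) = (if i = j then 1 else 0) \<and> dot (2*k) (a i) (c j) = 0) \<and>
     (\<forall>x\<in>?U. dot (2*k) x (Jmul (c i)) = \<alpha> i * dot (2*k) x (a i) \<and>
             dot (2*k) x (Jmul (a i)) = - \<alpha> i * dot (2*k) x (c i))"
    by blast
  have al: "sqrt (\<alpha> i) * sqrt (\<alpha> i) = \<alpha> i" "sqrt (\<alpha> i) > 0" "\<alpha> i > 0" if "i < N" for i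
    using W that by (auto simp: less_imp_le)
  \<comment> \<open>Dividing by sqrt (\<alpha> i) turns a . J c = \<alpha> into the canonical e . J
    f = 1; the squared lengths become \<nu> i = 1 / \<alpha> i.\<close>
  define e f where "e i = (\<lambda>l. 1 / sqrt (\<alpha> i) * a i l)" and "f i = (\<lambda>l. 1 / sqrt (\<alpha> i) * c i l)" for i
  have ca: "dot (2*k) (c i) (a j) = 0" if "i < N" "j < N" for i j
    using W that dot_commute by metis
  have ef: "dot (2*k) (e i) (e j) = (if i = j then 1 / \<alpha> i else 0)"
    "dot (2*k) (f i) (f j) = (if i = j then 1 / \<alpha> i else 0)" "dot (2*k) (e i) (f j) = 0"
    "dot (2*k) (e i) (Jmul (f j)) = (if i = j then 1 else 0)"
    "dot (2*k) (e i) (Jmul (e j)) = 0" "dot (2*k) (f i) (Jmul (f j)) = 0"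
    if "i < N" "j < N" for i j
    using W that al[OF that(1)] al[OF that(2)] ca[OF that]
    unfolding e_def f_def Jmul_linear dot_linear by (auto simp: field_simps)
  have efU: "e i \<in> ?U" "f i \<in> ?U" if "i < N" for i
  proof -
    have "a i \<in> ?U" "c i \<in> ?U" using W that by blast+
    then show "e i \<in> ?U" "f i \<in> ?U" unfolding U_iff e_def f_def dot_scale_left by auto
  qed
  have "2*N \<le> k" using NM by (simp add: k_def)
  from two_mode_squeezing_normal_form[OF this ef] obtain G q where
    G: "\<forall>i<N. 1 \<le> G i" and qq: "\<forall>i<k. \<forall>j<k. dot (2*k) (q i) (q j) = (if i = j then 1 else 0)"
    and qJ: "\<forall>i<k. \<forall>j<k. dot (2*k) (q i) (Jmul (q j)) = 0"
    and qe: "\<forall>i<N. \<forall>l<2*k. sqrt (G i) * q i l + sqrt (G i - 1) * q (N + i) l = e i l"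
    and qf: "\<forall>i<N. \<forall>l<2*k. sqrt (G i) * q i l - sqrt (G i - 1) * q (N + i) l = Jmul (f i) l"
    by blast
  \<comment> \<open>Columns 2i and 2i+1 are q i and -J (q i), so the symplectic product of the pair
    is q i . J (-J (q i)) = q i . q i = 1. Hence Q is orthogonal and symplectic at once.\<close>
  define w where "w j = (\<lambda>l. if even j then q (j div 2) l else - Jmul (q (j div 2)) l)" for j
  define Q where "Q = mat n n (\<lambda>(l,j). w j l)"
  have Q: "Q \<in> carrier_mat (2*k) (2*k)" by (simp add: Q_def n_def)
  have wQ: "dot (2*k) (\<lambda>l. Q $$ (l,i)) x = dot (2*k) (w i) x" if "i < 2*k" for i x
    using that by (intro dot_cong) (auto simp: Q_def n_def)
  have JQ: "Jmul (\<lambda>l. Q $$ (l,j)) l = Jmul (w j) l" if "j < 2*k" "l < 2*k" for j l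
  proof -
    have "even l \<Longrightarrow> Suc l < 2*k" using that(2) by presburger
    then show ?thesis using that by (auto simp: Jmul_def Q_def n_def)
  qed
  have w: "even j \<Longrightarrow> w j = q (j div 2)" "odd j \<Longrightarrow> w j = (\<lambda>l. - Jmul (q (j div 2)) l)" for j
    by (auto simp: w_def)
  have same: "i = j \<longleftrightarrow> i div 2 = j div 2 \<and> (even i \<longleftrightarrow> even j)" for i j :: nat by presburger
  have Q1: "transpose_mat Q * Q = 1\<^sub>m (2*k)"
  proof (rule eq_matI)
    fix i j assume "i < dim_row (1\<^sub>m (2*k) :: real mat)" "j < dim_col (1\<^sub>m (2*k) :: real mat)"
    then have ij: "i < 2*k" "j < 2*k" by auto
    then have d: "i div 2 < k" "j div 2 < k" by auto
    have "(transpose_mat Q * Q) $$ (i,j) = dot (2*k) (\<lambda>l. Q $$ (l,i)) (\<lambda>l. Q $$ (l,j))"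
      using ij Q by (subst mult_entry_sum[of _ "2*k" "2*k" _ "2*k"]) (auto simp: dot_def)
    also have "\<dots> = dot (2*k) (w i) (w j)" using ij by (intro dot_cong) (auto simp: Q_def n_def)
    also have "\<dots> = (if i = j then 1 else 0)"
      using qq qJ d same[of i j]
      by (cases "even i"; cases "even j") (simp_all add: w dot_linear dot_Jmul_left Jmul_Jmul)
    finally show "(transpose_mat Q * Q) $$ (i,j) = 1\<^sub>m (2*k) $$ (i,j)" using ij by simp
  qed (use Q in auto)
  have sQ: "symplectic k Q"
  proof (rule symplecticI_transpose[OF Q], rule eq_matI)
    fix i j assume "i < dim_row (Omega k)" "j < dim_col (Omega k)"
    then have ij: "i < 2*k" "j < 2*k" by auto
    then have d: "i div 2 < k" "j div 2 < k" by auto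
    have "(transpose_mat Q * Omega k * Q) $$ (i,j) = dot (2*k) (w i) (Jmul (\<lambda>l. Q $$ (l,j)))"
      using sandwich_entry[OF Q Q ij] wQ[OF ij(1)] by simp
    also have "\<dots> = dot (2*k) (w i) (Jmul (w j))" using JQ[OF ij(2)] by (intro dot_cong) auto
    also have "\<dots> = (if i div 2 = j div 2 then if even i \<and> odd j then 1 else if odd i \<and> even j then -1 else 0 else 0)"
      using qq qJ d
      by (cases "even i"; cases "even j") (simp_all add: w dot_linear dot_Jmul_Jmul dot_Jmul_left Jmul_linear Jmul_Jmul)
    also have "\<dots> = Omega k $$ (i,j)"
      using ij by (auto simp: Omega_def; presburger)
    finally show "(transpose_mat Q * Omega k * Q) $$ (i,j) = Omega k $$ (i,j)" .
  qed (use Q in auto)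
  let ?T = "tms_enc N M G"
  define X where "X = Q * ?T"
  have sT: "symplectic k ?T" unfolding k_def by (rule symplectic_tms_enc[OF N NM G])
  have sX: "symplectic k X" unfolding X_def by (rule symplectic_mult[OF sQ sT])
  note Xc = symplectic_carrier[OF sX] and Tc = symplectic_carrier[OF sT]
  \<comment> \<open>The even columns are the sum equation for e. In the odd ones the minus sign of Z
    produces -J (sqrt (G i) q i - sqrt (G i - 1) q (N + i)) = -J (J (f i)) = f i.\<close>
  have Xcol: "X $$ (l,j) = (if even j then e (j div 2) l else f (j div 2) l)" if j: "j < 2*N" and l: "l < 2*k" for l j
  proof -
    have j': "j < 2*(N+M)" "j < 2*k" "j + 2*N < 2*k" using j NM by (auto simp: k_def)
    have "X $$ (l,j) = (\<Sum>r<2*k. Q $$ (l,r) * ?T $$ (r,j))"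
      unfolding X_def using Q Tc j' l by (intro mult_entry_sum) auto
    also have "\<dots> = (\<Sum>r<2*k. (if r = j then Q $$ (l,r) * tms_diag N G j else 0) + (if r = j + 2*N then Q $$ (l,r) * tms_offdiag N G j else 0))"
      using tms_enc_entry[of _ N M j G] j' N j by (intro sum.cong) (auto simp: k_def partner_def)
    also have "\<dots> = Q $$ (l,j) * tms_diag N G j + Q $$ (l,j + 2*N) * tms_offdiag N G j"
      using j' by (simp add: sum.distrib)
    also have "\<dots> = w j l * tms_diag N G j + w (j + 2*N) l * tms_offdiag N G j"
      using j' l by (simp add: Q_def n_def)
    also have "\<dots> = (if even j then e (j div 2) l else f (j div 2) l)"
    proof (cases "even j")
      case True
      then show ?thesis using qe j l by (auto simp: w_def tms_diag_def tms_offdiag_def algebra_simps)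
    next
      case False
      define i where "i = j div 2"
      have i: "i < N" using j by (simp add: i_def)
      have ev: "even l \<Longrightarrow> Suc l < 2*k" using l by presburger
      have "Jmul (\<lambda>l. sqrt (G i) * q i l - sqrt (G i - 1) * q (N + i) l) l = Jmul (Jmul (f i)) l"
        unfolding Jmul_def[of "\<lambda>l. sqrt (G i) * q i l - sqrt (G i - 1) * q (N + i) l"] Jmul_def[of "Jmul (f i)"]
        using qf i l ev by auto
      then have "sqrt (G i) * Jmul (q i) l - sqrt (G i - 1) * Jmul (q (N + i)) l = - f i l"
        by (simp add: Jmul_linear Jmul_Jmul)
      moreover have "(j + 2*N) div 2 = N + i" by (simp add: i_def)
      ultimately show ?thesis using False j by (simp add: w_def tms_diag_def tms_offdiag_def i_def[symmetric] algebra_simps)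
    qed
    finally show ?thesis .
  qed
  define P where "P = sinv k X * S"
  note Ic = sinv_carrier[OF Xc]
  have Pc: "P \<in> carrier_mat (2*k) (2*k)" unfolding P_def using Ic Sc by (rule mult_carrier_mat)
  have sP: "symplectic k P" unfolding P_def by (rule symplectic_mult[OF symplectic_sinv[OF sX] S'])
  have XP: "X * P = S"
  proof -
    have "X * P = X * sinv k X * S" unfolding P_def using Xc Ic Sc by (intro assoc_mult_mat[symmetric]) auto
    then show ?thesis using mult_sinv(1)[OF sX] Sc by simp
  qed
  \<comment> \<open>The data columns of X are the vectors e and f, which lie in U and so are
    symplectically orthogonal to the ancilla columns of S.\<close>
  have Z: "(transpose_mat X * Omega k * S) $$ (j, 2*N + l) = 0" if "j < 2*N" "l < 2*M" for j l
  proof -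
    have j: "j < 2*k" "2*N + l < 2*k" using that by (auto simp: k_def)
    have "(transpose_mat X * Omega k * S) $$ (j, 2*N + l) = dot n (\<lambda>r. X $$ (r,j)) (Jmul (s (2*N + l)))"
      using sandwich_entry[OF Xc Sc j] by (simp add: n_def s_def)
    also have "\<dots> = dot n (if even j then e (j div 2) else f (j div 2)) (Jmul (s (2*N + l)))"
      using Xcol[OF that(1)] by (intro dot_cong) (auto simp: n_def)
    also have "\<dots> = 0" using efU[of "j div 2"] that unfolding U_iff by auto
    finally show ?thesis .
  qed
  \<comment> \<open>P = -Omega (X^T Omega S), and the left factor Omega only exchanges the two rows
    of each mode up to sign, so the zero block persists.\<close>
  have PZ: "P $$ (i, 2*N + l) = 0" if "i < 2*N" "l < 2*M" for i l
  proof -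
    let ?Y = "transpose_mat X * Omega k * S"
    have Y: "?Y \<in> carrier_mat (2*k) (2*k)" using Xc Sc by auto
    have il: "i < 2*k" "2*N + l < 2*k" using that by (auto simp: k_def)
    have "P = - (Omega k * transpose_mat X * Omega k * S)"
      using Xc Sc by (simp add: P_def sinv_def)
    also have "Omega k * transpose_mat X * Omega k * S = Omega k * ?Y"
    proof -
      have "Omega k * transpose_mat X * Omega k = Omega k * (transpose_mat X * Omega k)"
        using Xc by (intro assoc_mult_mat[of _ "2*k" "2*k" _ "2*k" _ "2*k"]) auto
      then show ?thesis
        using Xc Sc by (simp only:) (intro assoc_mult_mat[of _ "2*k" "2*k" _ "2*k" _ "2*k"], auto)
    qed
    finally have "P $$ (i, 2*N + l) = - ((Omega k * ?Y) $$ (i, 2*N + l))" using il Sc by simp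
    also have "(Omega k * ?Y) $$ (i, 2*N + l) = Jmul (\<lambda>r. ?Y $$ (r, 2*N + l)) i"
      by (rule Omega_mult_entry[OF Y il])
    also have "\<dots> = 0"
    proof -
      have "even i \<Longrightarrow> Suc i < 2*N" "i - 1 < 2*N" using that(1) by presburger+
      then show ?thesis using Z[OF _ that(2)] unfolding Jmul_def by auto
    qed
    finally show ?thesis by simp
  qed
  obtain A B C D where sb: "split_block P (2*N) (2*N) = (A,B,C,D)" by (cases "split_block P (2*N) (2*N)") auto
  have dims: "dim_row P = 2*N + 2*M" "dim_col P = 2*N + 2*M" using Pc by (auto simp: k_def)
  note blk = split_block[OF sb dims]
  have "B = 0\<^sub>m (2*N) (2*M)"
  proof (rule eq_matI)
    fix i j assume "i < dim_row (0\<^sub>m (2*N) (2*M) :: real mat)" "j < dim_col (0\<^sub>m (2*N) (2*M) :: real mat)"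
    then have ij: "i < 2*N" "j < 2*M" by auto
    have "P $$ (i, 2*N + j) = B $$ (i,j)" using blk ij by (subst blk(5)) auto
    then show "B $$ (i,j) = 0\<^sub>m (2*N) (2*M) $$ (i,j)" using PZ[OF ij] ij by simp
  qed (use blk in auto)
  then have PB: "P = four_block_mat A (0\<^sub>m (2*N) (2*M)) C D" using blk(5) by simp
  note fin = symplectic_block_triangular[OF blk(1,3,4), folded PB, OF sP[unfolded k_def]]
  show ?thesis
    by (rule that[OF G Q[unfolded k_def] Q1[unfolded k_def] fin(1,3)]) (use XP PB fin(2) X_def in simp)
qed

section \<open>Rotation invariance of Gaussian noise\<close>

definition leb :: "nat \<Rightarrow> (nat \<Rightarrow> real) measure" where
  "leb d = PiM {..<d} (\<lambda>_. lborel)"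

text \<open>The restriction keeps the image among the extensional functions, the space of the
  product measure.\<close>

definition lin :: "nat \<Rightarrow> (nat \<Rightarrow> nat \<Rightarrow> real) \<Rightarrow> (nat \<Rightarrow> real) \<Rightarrow> nat \<Rightarrow> real" where
  "lin d Q x = (\<lambda>i\<in>{..<d}. \<Sum>j<d. Q i j * x j)"

lemma sets_leb [measurable_cong]: "sets (leb d) = sets (PiM {..<d} (\<lambda>_. borel))"
  unfolding leb_def by (intro sets_PiM_cong) auto

lemma space_leb: "space (leb d) = extensional {..<d}"
  by (auto simp: leb_def space_PiM PiE_def)

lemma sigma_finite_leb: "sigma_finite_measure (leb d)"
proof -
  interpret product_sigma_finite "\<lambda>_::nat. lborel :: real measure" by standard
  interpret finite_product_sigma_finite "\<lambda>_::nat. lborel :: real measure" "{..<d}" by standard auto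
  show ?thesis unfolding leb_def by (rule sigma_finite_measure_axioms)
qed

lemma lin_measurable [measurable]:
  "lin d Q \<in> PiM {..<d} (\<lambda>_. borel) \<rightarrow>\<^sub>M PiM {..<d} (\<lambda>_. borel)"
  unfolding lin_def by measurable

text \<open>A product measure is determined by its values on boxes, where the claim is translation
  invariance of \<open>lborel\<close> in each coordinate.\<close>

lemma leb_translation_distr: "distr (leb d) (leb d) (\<lambda>x. \<lambda>i\<in>{..<d}. x i + c i) = leb d"
proof -
  interpret product_sigma_finite "\<lambda>_::nat. lborel :: real measure" by standard
  have m: "(\<lambda>x. \<lambda>i\<in>{..<d}. x i + c i) \<in> leb d \<rightarrow>\<^sub>M leb d"
    by measurable
  show ?thesis
    unfolding leb_def[of d, symmetric]
    apply (subst (3) leb_def)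
  proof (rule PiM_eqI)
    show "sets (distr (leb d) (leb d) (\<lambda>x. \<lambda>i\<in>{..<d}. x i + c i)) = sets (PiM {..<d} (\<lambda>_. lborel))"
      by (simp add: leb_def)
    fix A :: "nat \<Rightarrow> real set" assume A: "\<And>i. i \<in> {..<d} \<Longrightarrow> A i \<in> sets lborel"
    have "emeasure (distr (leb d) (leb d) (\<lambda>x. \<lambda>i\<in>{..<d}. x i + c i)) (Pi\<^sub>E {..<d} A)
      = emeasure (leb d) ((\<lambda>x. \<lambda>i\<in>{..<d}. x i + c i) -` (Pi\<^sub>E {..<d} A) \<inter> space (leb d))"
      using A by (intro emeasure_distr[OF m]) (simp add: leb_def sets_PiM_I_finite)
    also have "(\<lambda>x. \<lambda>i\<in>{..<d}. x i + c i) -` (Pi\<^sub>E {..<d} A) \<inter> space (leb d)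
      = Pi\<^sub>E {..<d} (\<lambda>i. (\<lambda>t. c i + t) -` A i)"
      by (auto simp: space_leb PiE_iff extensional_def add.commute)
    also have "emeasure (leb d) \<dots> = (\<Prod>i<d. emeasure lborel ((\<lambda>t. c i + t) -` A i))"
      unfolding leb_def using A by (intro emeasure_PiM) (auto intro!: measurable_sets_borel[where M = borel])
    also have "\<dots> = (\<Prod>i<d. emeasure lborel (A i))"
    proof (intro prod.cong refl)
      fix i assume "i \<in> {..<d}"
      then have "emeasure (distr lborel borel ((+) (c i))) (A i) = emeasure lborel ((\<lambda>t. c i + t) -` A i)"
        using A by (subst emeasure_distr) auto
      then show "emeasure lborel ((\<lambda>t. c i + t) -` A i) = emeasure lborel (A i)"
        by (simp add: lborel_distr_plus)
    qed
    finally show "emeasure (distr (leb d) (leb d) (\<lambda>x. \<lambda>i\<in>{..<d}. x i + c i)) (Pi\<^sub>E {..<d} A)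
       = (\<Prod>i<d. emeasure lborel (A i))" .
  qed auto
qed

lemma leb_translation:
  assumes g [measurable]: "g \<in> borel_measurable (PiM {..<d} (\<lambda>_. borel))"
  shows "(\<integral>\<^sup>+x. g (\<lambda>i\<in>{..<d}. x i + c i) \<partial>leb d) = (\<integral>\<^sup>+x. g x \<partial>leb d)"
proof -
  have "(\<integral>\<^sup>+x. g x \<partial>leb d) = (\<integral>\<^sup>+x. g x \<partial>(distr (leb d) (leb d) (\<lambda>x. \<lambda>i\<in>{..<d}. x i + c i)))"
    by (simp add: leb_translation_distr)
  also have "\<dots> = (\<integral>\<^sup>+x. g (\<lambda>i\<in>{..<d}. x i + c i) \<partial>leb d)"
    by (rule nn_integral_distr) measurable
  finally show ?thesis by simp
qed

definition gauss :: "nat \<Rightarrow> real \<Rightarrow> (nat \<Rightarrow> real) \<Rightarrow> ennreal" where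
  "gauss d \<sigma> x = (\<Prod>i<d. ennreal (normal_density 0 \<sigma> (x i)))"

lemma gauss_measurable [measurable]: "gauss d \<sigma> \<in> borel_measurable (PiM {..<d} (\<lambda>_. borel))"
  unfolding gauss_def[abs_def] by measurable

lemma gauss_cong: "(\<And>i. i < d \<Longrightarrow> x i = y i) \<Longrightarrow> gauss d \<sigma> x = gauss d \<sigma> y"
  by (simp add: gauss_def)

text \<open>The density depends on x only through the sum of squares, which is the source of its
  rotation invariance.\<close>

lemma gauss_eq: "gauss d \<sigma> x = ennreal ((1 / sqrt (2*pi*\<sigma>\<^sup>2)) ^ d * exp (- (\<Sum>i<d. (x i)\<^sup>2) / (2*\<sigma>\<^sup>2)))"
proof -
  have "gauss d \<sigma> x = ennreal (\<Prod>i<d. normal_density 0 \<sigma> (x i))"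
    unfolding gauss_def by (rule prod_ennreal) (simp add: normal_density_nonneg)
  also have "(\<Prod>i<d. normal_density 0 \<sigma> (x i)) = (1 / sqrt (2*pi*\<sigma>\<^sup>2)) ^ d * exp (- (\<Sum>i<d. (x i)\<^sup>2) / (2*\<sigma>\<^sup>2))"
    by (simp add: normal_density_def prod.distrib exp_sum[symmetric] sum_negf sum_divide_distrib prod_dividef power_divide)
  finally show ?thesis .
qed

lemma nn_integral_gauss:
  assumes "\<sigma> > 0" shows "(\<integral>\<^sup>+x. gauss d \<sigma> x \<partial>leb d) = 1"
proof -
  interpret product_sigma_finite "\<lambda>_::nat. lborel :: real measure" by standard
  have "(\<integral>\<^sup>+t. ennreal (normal_density 0 \<sigma> t) \<partial>lborel) = 1"
    using prob_space.emeasure_space_1[OF prob_space_normal_density[OF assms, of 0]]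
    by (simp add: emeasure_density)
  then show ?thesis
    unfolding leb_def gauss_def by (subst product_nn_integral_prod) auto
qed

text \<open>On a box the density integral factors over the coordinates. Rotation invariance thus
  splits into that of \<open>leb\<close> and that of the density.\<close>

lemma noise_eq_density: "noise d \<sigma> = density (leb d) (gauss d \<sigma>)" if "\<sigma> > 0"
proof -
  interpret product_sigma_finite "\<lambda>_::nat. lborel :: real measure" by standard
  interpret N: product_sigma_finite "\<lambda>_::nat. density lborel (normal_density 0 \<sigma>)"
    using prob_space_imp_sigma_finite[OF prob_space_normal_density[OF that, of 0]]
    by (simp add: product_sigma_finite_def)
  show ?thesis
    unfolding noise_def
  proof (rule N.PiM_eqI[symmetric])
    show "sets (density (leb d) (gauss d \<sigma>)) = sets (PiM {..<d} (\<lambda>_. density lborel (normal_density 0 \<sigma>)))"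
      by (simp add: sets_leb cong: sets_PiM_cong)
    fix A :: "nat \<Rightarrow> real set" assume "\<And>i. i \<in> {..<d} \<Longrightarrow> A i \<in> sets (density lborel (normal_density 0 \<sigma>))"
    then have A: "\<And>i. i < d \<Longrightarrow> A i \<in> sets borel" by auto
    have "emeasure (density (leb d) (gauss d \<sigma>)) (Pi\<^sub>E {..<d} A)
        = (\<integral>\<^sup>+x. gauss d \<sigma> x * indicator (Pi\<^sub>E {..<d} A) x \<partial>leb d)"
      using A by (intro emeasure_density) (auto simp: sets_leb intro!: sets_PiM_I_finite)
    also have "\<dots> = (\<integral>\<^sup>+x. (\<Prod>i<d. ennreal (normal_density 0 \<sigma> (x i)) * indicator (A i) (x i)) \<partial>leb d)"
    proof (intro nn_integral_cong)
      fix x assume "x \<in> space (leb d)"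
      then have "indicator (Pi\<^sub>E {..<d} A) x = (\<Prod>i<d. indicator (A i) (x i) :: ennreal)"
        by (auto simp: space_leb PiE_iff indicator_def)
      then show "gauss d \<sigma> x * indicator (Pi\<^sub>E {..<d} A) x
          = (\<Prod>i<d. ennreal (normal_density 0 \<sigma> (x i)) * indicator (A i) (x i))"
        by (simp add: gauss_def prod.distrib)
    qed
    also have "\<dots> = (\<Prod>i<d. \<integral>\<^sup>+t. ennreal (normal_density 0 \<sigma> t) * indicator (A i) t \<partial>lborel)"
      unfolding leb_def using A by (subst product_nn_integral_prod) auto
    also have "\<dots> = (\<Prod>i<d. emeasure (density lborel (normal_density 0 \<sigma>)) (A i))"
      using A by (intro prod.cong refl emeasure_density[symmetric]) auto
    finally show "emeasure (density (leb d) (gauss d \<sigma>)) (Pi\<^sub>E {..<d} A)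
       = (\<Prod>i<d. emeasure (density lborel (normal_density 0 \<sigma>)) (A i))" .
  qed auto
qed

section \<open>Orthogonal changes of variables\<close>

locale orthogonal_map =
  fixes d :: nat and Q :: "nat \<Rightarrow> nat \<Rightarrow> real"
  assumes rows: "i < d \<Longrightarrow> j < d \<Longrightarrow> (\<Sum>k<d. Q i k * Q j k) = (if i = j then 1 else 0)"
    and cols: "i < d \<Longrightarrow> j < d \<Longrightarrow> (\<Sum>k<d. Q k i * Q k j) = (if i = j then 1 else 0)"
begin

lemma norm_lin: "(\<Sum>i<d. (lin d Q x i)\<^sup>2) = (\<Sum>i<d. (x i)\<^sup>2)"
proof -
  have "(\<Sum>i<d. (lin d Q x i)\<^sup>2) = (\<Sum>i<d. \<Sum>j<d. \<Sum>k<d. (Q i j * Q i k) * (x j * x k))"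
    by (simp add: lin_def power2_eq_square sum_product mult_ac)
  also have "\<dots> = (\<Sum>j<d. \<Sum>i<d. \<Sum>k<d. (Q i j * Q i k) * (x j * x k))"
    by (rule sum.swap)
  also have "\<dots> = (\<Sum>j<d. \<Sum>k<d. \<Sum>i<d. (Q i j * Q i k) * (x j * x k))"
    by (intro sum.cong refl sum.swap)
  also have "\<dots> = (\<Sum>j<d. \<Sum>k<d. if j = k then x j * x k else 0)"
    by (intro sum.cong refl) (simp add: cols flip: sum_distrib_right)
  also have "\<dots> = (\<Sum>j<d. (x j)\<^sup>2)"
    by (intro sum.cong refl) (simp add: power2_eq_square)
  finally show ?thesis .
qed

lemma lin_transpose: "i < d \<Longrightarrow> lin d Q (lin d (\<lambda>i j. Q j i) x) i = x i"
proof -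
  assume i: "i < d"
  have "lin d Q (lin d (\<lambda>i j. Q j i) x) i = (\<Sum>j<d. \<Sum>k<d. Q i j * Q k j * x k)"
    using i by (simp add: lin_def sum_distrib_left mult_ac)
  also have "\<dots> = (\<Sum>k<d. \<Sum>j<d. Q i j * Q k j * x k)" by (rule sum.swap)
  also have "\<dots> = (\<Sum>k<d. if i = k then x k else 0)"
    using i by (intro sum.cong refl) (simp add: rows flip: sum_distrib_right)
  also have "\<dots> = x i" using i by simp
  finally show ?thesis .
qed

lemma gauss_lin: "gauss d \<sigma> (lin d Q x) = gauss d \<sigma> x"
  by (simp add: gauss_eq norm_lin)

text \<open>The argument for the uniqueness of Haar measure, applied to Lebesgue measure and its image
  under Q: weighting by a Q-invariant density of mass one makes the proportionality constant 1.\<close>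

lemma leb_lin:
  assumes g [measurable]: "g \<in> borel_measurable (PiM {..<d} (\<lambda>_. borel))"
  shows "(\<integral>\<^sup>+y. g (lin d Q y) \<partial>leb d) = (\<integral>\<^sup>+x. g x \<partial>leb d)"
proof -
  interpret L: sigma_finite_measure "leb d" by (rule sigma_finite_leb)
  interpret P: pair_sigma_finite "leb d" "leb d" ..
  let ?h = "gauss d 1"
  have m1 [measurable]: "(\<lambda>p. \<lambda>i\<in>{..<d}. fst p i + lin d Q (snd p) i) \<in> leb d \<Otimes>\<^sub>M leb d \<rightarrow>\<^sub>M PiM {..<d} (\<lambda>_. borel)"
    by measurable
  have m2 [measurable]: "(\<lambda>p. \<lambda>i\<in>{..<d}. lin d Q (snd p) i - fst p i) \<in> leb d \<Otimes>\<^sub>M leb d \<rightarrow>\<^sub>M PiM {..<d} (\<lambda>_. borel)"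
    by measurable
  \<comment> \<open>Insert the total mass 1 of the Gaussian in y; then, for each fixed y, translate
    x by Q y.\<close>
  have "(\<integral>\<^sup>+x. g x \<partial>leb d) = (\<integral>\<^sup>+y. ?h y * (\<integral>\<^sup>+x. g x \<partial>leb d) \<partial>leb d)"
    by (simp add: nn_integral_multc nn_integral_gauss)
  also have "\<dots> = (\<integral>\<^sup>+y. (\<integral>\<^sup>+x. ?h y * g (\<lambda>i\<in>{..<d}. x i + lin d Q y i) \<partial>leb d) \<partial>leb d)"
    by (subst nn_integral_cmult) (simp_all add: leb_translation)
  \<comment> \<open>Invariance of the Gaussian moves its argument from y to Q y, so that a later
    shift of y acts in the same way on both factors.\<close>
  also have "\<dots> = (\<integral>\<^sup>+x. (\<integral>\<^sup>+y. ?h (lin d Q y) * g (\<lambda>i\<in>{..<d}. x i + lin d Q y i) \<partial>leb d) \<partial>leb d)"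
    unfolding gauss_lin by (rule P.Fubini') measurable
  \<comment> \<open>Shift y by -Q^T x, which replaces Q y by Q y - x: x disappears from the argument
    of g and survives only in the Gaussian.\<close>
  also have "\<dots> = (\<integral>\<^sup>+x. (\<integral>\<^sup>+y. ?h (\<lambda>i\<in>{..<d}. lin d Q y i - x i) * g (lin d Q y) \<partial>leb d) \<partial>leb d)"
  proof (rule nn_integral_cong)
    fix x assume "x \<in> space (leb d)"
    define t where "t = lin d (\<lambda>i j. Q j i) x"
    have lt: "lin d Q (\<lambda>i\<in>{..<d}. y i + - t i) i = lin d Q y i - x i" if "i < d" for y i
    proof -
      have "lin d Q (\<lambda>i\<in>{..<d}. y i + - t i) i = lin d Q y i - lin d Q t i"
        using that by (simp add: lin_def algebra_simps sum_subtractf)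
      then show ?thesis using lin_transpose[OF that, of x] by (simp add: t_def)
    qed
    have [measurable]: "(\<lambda>y. \<lambda>i\<in>{..<d}. x i + lin d Q y i) \<in> PiM {..<d} (\<lambda>_. borel) \<rightarrow>\<^sub>M PiM {..<d} (\<lambda>_. borel)"
      by measurable
    have "(\<integral>\<^sup>+y. ?h (lin d Q y) * g (\<lambda>i\<in>{..<d}. x i + lin d Q y i) \<partial>leb d)
       = (\<integral>\<^sup>+y. ?h (lin d Q (\<lambda>i\<in>{..<d}. y i + - t i)) * g (\<lambda>i\<in>{..<d}. x i + lin d Q (\<lambda>i\<in>{..<d}. y i + - t i) i) \<partial>leb d)"
      by (rule leb_translation[symmetric]) measurable
    also have "\<dots> = (\<integral>\<^sup>+y. ?h (\<lambda>i\<in>{..<d}. lin d Q y i - x i) * g (lin d Q y) \<partial>leb d)"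
    proof (intro nn_integral_cong arg_cong2[where f = "(*)"])
      fix y
      show "?h (lin d Q (\<lambda>i\<in>{..<d}. y i + - t i)) = ?h (\<lambda>i\<in>{..<d}. lin d Q y i - x i)"
        using lt[of _ y] by (intro gauss_cong) simp
      have "(\<lambda>i\<in>{..<d}. x i + lin d Q (\<lambda>i\<in>{..<d}. y i + - t i) i) = lin d Q y"
        using lt[of _ y] by (auto simp: fun_eq_iff lin_def)
      then show "g (\<lambda>i\<in>{..<d}. x i + lin d Q (\<lambda>i\<in>{..<d}. y i + - t i) i) = g (lin d Q y)" by simp
    qed
    finally show "(\<integral>\<^sup>+y. ?h (lin d Q y) * g (\<lambda>i\<in>{..<d}. x i + lin d Q y i) \<partial>leb d)
       = (\<integral>\<^sup>+y. ?h (\<lambda>i\<in>{..<d}. lin d Q y i - x i) * g (lin d Q y) \<partial>leb d)" .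
  qed
  also have "\<dots> = (\<integral>\<^sup>+y. (\<integral>\<^sup>+x. ?h (\<lambda>i\<in>{..<d}. lin d Q y i - x i) * g (lin d Q y) \<partial>leb d) \<partial>leb d)"
    by (rule P.Fubini'[symmetric]) measurable
  also have "\<dots> = (\<integral>\<^sup>+y. g (lin d Q y) \<partial>leb d)"
  proof (intro nn_integral_cong)
    fix y
    \<comment> \<open>Translating x by Q y leaves the Gaussian at -x, which by evenness has total
      mass 1.\<close>
    have "(\<integral>\<^sup>+x. ?h (\<lambda>i\<in>{..<d}. lin d Q y i - x i) \<partial>leb d)
       = (\<integral>\<^sup>+x. ?h (\<lambda>i\<in>{..<d}. lin d Q y i - (\<lambda>i\<in>{..<d}. x i + lin d Q y i) i) \<partial>leb d)"
      by (rule leb_translation[symmetric]) measurable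
    also have "\<dots> = (\<integral>\<^sup>+x. ?h x \<partial>leb d)"
      by (intro nn_integral_cong) (simp add: gauss_eq)
    finally have "(\<integral>\<^sup>+x. ?h (\<lambda>i\<in>{..<d}. lin d Q y i - x i) \<partial>leb d) = 1"
      by (simp add: nn_integral_gauss)
    moreover have "(\<lambda>x. ?h (\<lambda>i\<in>{..<d}. lin d Q y i - x i)) \<in> borel_measurable (leb d)"
      by measurable
    ultimately show "(\<integral>\<^sup>+x. ?h (\<lambda>i\<in>{..<d}. lin d Q y i - x i) * g (lin d Q y) \<partial>leb d) = g (lin d Q y)"
      by (simp add: nn_integral_multc)
  qed
  finally show ?thesis by simp
qed

lemma distr_noise_lin:
  assumes "\<sigma> > 0" shows "distr (noise d \<sigma>) (noise d \<sigma>) (lin d Q) = noise d \<sigma>"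
proof (rule measure_eqI)
  have sn [measurable_cong]: "sets (noise d \<sigma>) = sets (PiM {..<d} (\<lambda>_. borel))"
    by (simp add: noise_eq_density[OF assms] sets_leb)
  fix A assume "A \<in> sets (distr (noise d \<sigma>) (noise d \<sigma>) (lin d Q))"
  then have A [measurable]: "A \<in> sets (PiM {..<d} (\<lambda>_. borel))" by (simp add: sn)
  have e: "emeasure (noise d \<sigma>) B = (\<integral>\<^sup>+x. gauss d \<sigma> x * indicator B x \<partial>leb d)"
    if "B \<in> sets (PiM {..<d} (\<lambda>_. borel))" for B
    unfolding noise_eq_density[OF assms] using that
    by (intro emeasure_density) (auto simp: sets_leb)
  have lA: "lin d Q -` A \<inter> space (noise d \<sigma>) \<in> sets (PiM {..<d} (\<lambda>_. borel))"
    using measurable_sets[of "lin d Q" "noise d \<sigma>" "noise d \<sigma>" A] A sn by auto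
  have "emeasure (distr (noise d \<sigma>) (noise d \<sigma>) (lin d Q)) A = emeasure (noise d \<sigma>) (lin d Q -` A \<inter> space (noise d \<sigma>))"
    by (rule emeasure_distr) (auto simp: sn)
  also have "\<dots> = (\<integral>\<^sup>+x. gauss d \<sigma> (lin d Q x) * indicator A (lin d Q x) \<partial>leb d)"
    unfolding e[OF lA] gauss_lin
    by (intro nn_integral_cong) (auto simp: indicator_def noise_eq_density[OF assms])
  also have "\<dots> = (\<integral>\<^sup>+x. gauss d \<sigma> x * indicator A x \<partial>leb d)"
    by (rule leb_lin) measurable
  also have "\<dots> = emeasure (noise d \<sigma>) A" by (simp add: e)
  finally show "emeasure (distr (noise d \<sigma>) (noise d \<sigma>) (lin d Q)) A = emeasure (noise d \<sigma>) A" .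
qed simp

end

section \<open>Transformation of codes\<close>

lemma mult_vec_sum: "B \<in> carrier_mat m n \<Longrightarrow> v \<in> carrier_vec n \<Longrightarrow> i < m \<Longrightarrow> (B *\<^sub>v v) $ i = (\<Sum>j<n. B $$ (i,j) * v $ j)"
  by (simp add: scalar_prod_def lessThan_atLeast0)

lemma Rmod_measurable [measurable]: "Rmod \<in> borel_measurable borel"
  unfolding Rmod_def[abs_def] by measurable

lemma inv_mat_symplectic: "symplectic n S \<Longrightarrow> inv_mat (2*n) S = sinv n S"
  using inv_mat_eq mult_sinv(1) symplectic_carrier sinv_carrier by metis

lemma decoded_noise_carrier:
  "symplectic (N+M) S \<Longrightarrow> decoded_noise N M S \<xi> \<in> carrier_vec (2*(N+M))"
  unfolding decoded_noise_def inv_mat_symplectic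
  using sinv_carrier[OF symplectic_carrier, of "N+M" S] by (intro mult_mat_vec_carrier) auto

lemma decoded_noise_measurable:
  assumes "symplectic (N+M) S" "i < 2*(N+M)"
  shows "(\<lambda>\<xi>. decoded_noise N M S \<xi> $ i) \<in> borel_measurable (PiM {..<2*(N+M)} (\<lambda>_. borel))"
proof -
  have "decoded_noise N M S \<xi> $ i = (\<Sum>j<2*(N+M). sinv (N+M) S $$ (i,j) * \<xi> j)" for \<xi>
    unfolding decoded_noise_def inv_mat_symplectic[OF assms(1)]
    using sinv_carrier[OF symplectic_carrier[OF assms(1)]] assms(2)
    by (subst mult_vec_sum[of _ "2*(N+M)" "2*(N+M)"]) auto
  then show ?thesis by simp
qed

lemma syndrome_measurable:
  assumes S: "symplectic (N+M) S" and L: "L \<in> carrier_mat (2*M) (2*M)"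
  shows "syndrome N M S L \<in> PiM {..<2*(N+M)} (\<lambda>_. borel) \<rightarrow>\<^sub>M PiM {..<2*M} (\<lambda>_. borel)"
proof -
  define B where "B = transpose_mat L * Omega M"
  have B: "B \<in> carrier_mat (2*M) (2*M)" using L by (auto simp: B_def)
  have "syndrome N M S L = (\<lambda>\<xi>. \<lambda>i\<in>{..<2*M}. Rmod (\<Sum>j<2*M. B $$ (i,j) * decoded_noise N M S \<xi> $ (2*N + j)))"
  proof (intro ext)
    fix \<xi> i
    let ?x = "vec (2*M) (\<lambda>i. decoded_noise N M S \<xi> $ (2*N + i))"
    have "transpose_mat L *\<^sub>v (Omega M *\<^sub>v ?x) = B *\<^sub>v ?x"
      unfolding B_def using L by (intro assoc_mult_mat_vec[symmetric, of _ "2*M" "2*M" _ "2*M"]) auto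
    moreover have "(B *\<^sub>v ?x) $ i = (\<Sum>j<2*M. B $$ (i,j) * decoded_noise N M S \<xi> $ (2*N + j))" if "i < 2*M"
      using that by (subst mult_vec_sum[OF B]) auto
    ultimately show "syndrome N M S L \<xi> i = (\<lambda>i\<in>{..<2*M}. Rmod (\<Sum>j<2*M. B $$ (i,j) * decoded_noise N M S \<xi> $ (2*N + j))) i"
      by (simp add: syndrome_def Let_def)
  qed
  moreover have "(\<lambda>\<xi>. decoded_noise N M S \<xi> $ (2*N + j)) \<in> borel_measurable (PiM {..<2*(N+M)} (\<lambda>_. borel))" if "j < 2*M" for j
    using that by (intro decoded_noise_measurable[OF S]) auto
  ultimately show ?thesis
    by (auto intro!: measurable_restrict measurable_compose[OF _ Rmod_measurable] borel_measurable_sum borel_measurable_times)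
qed

lemma residual_measurable:
  assumes S: "symplectic (N+M) S" and L: "L \<in> carrier_mat (2*M) (2*M)" and f: "estimator_measurable N M f" and i: "i < 2*N"
  shows "(\<lambda>\<xi>. residual N M S L f \<xi> i) \<in> borel_measurable (PiM {..<2*(N+M)} (\<lambda>_. borel))"
proof -
  have "(\<lambda>s. f s i) \<in> borel_measurable (PiM {..<2*M} (\<lambda>_. borel))" using f i by (simp add: estimator_measurable_def)
  from measurable_compose[OF syndrome_measurable[OF S L] this]
  show ?thesis unfolding residual_def using i
    by (intro borel_measurable_diff decoded_noise_measurable[OF S]) auto
qed

text \<open>(D L)^T Omega (D L) = L^T Omega L because D is symplectic, so the same integer matrix
  serves as witness.\<close>

lemma sympl_int_lattice_mult:
  assumes D: "symplectic M D" and L: "sympl_int_lattice M L"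
  shows "sympl_int_lattice M (D * L)"
proof -
  let ?d = "2*M"
  note Dc = symplectic_carrier[OF D] and Ic = sinv_carrier[OF symplectic_carrier[OF D]]
  have Lc: "L \<in> carrier_mat ?d ?d" and "invertible_mat L" using L by (auto simp: sympl_int_lattice_def)
  then obtain B where LB: "L * B = 1\<^sub>m ?d" and "B * L = 1\<^sub>m (dim_row B)"
    by (auto simp: invertible_mat_def inverts_mat_def)
  \<comment> \<open>The predicate \<open>invertible_mat\<close> does not state the size of the
    inverse; both dimensions are read off from the two product equations.\<close>
  then have Bc: "B \<in> carrier_mat ?d ?d" using Lc
    by (metis carrier_matD(2) carrier_matI index_mult_mat(3) index_one_mat(3))
  have "D * L * (B * sinv M D) = D * (L * B) * sinv M D"
    using Dc Lc Bc Ic by (simp add: assoc_mult_mat[of _ ?d ?d _ ?d _ ?d])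
  then have r: "D * L * (B * sinv M D) = 1\<^sub>m ?d" using LB mult_sinv(1)[OF D] Dc by simp
  have DLc: "D * L \<in> carrier_mat ?d ?d" and BIc: "B * sinv M D \<in> carrier_mat ?d ?d"
    using Dc Lc Bc Ic by auto
  have "B * sinv M D * (D * L) = 1\<^sub>m ?d" by (rule mat_mult_left_right_inverse[OF DLc BIc r])
  with r have inv: "invertible_mat (D * L)"
    unfolding invertible_mat_def inverts_mat_def using Dc Lc Bc Ic by (auto intro!: exI[of _ "B * sinv M D"])
  have "transpose_mat (D * L) * Omega M * (D * L) = transpose_mat L * (transpose_mat D * Omega M * D) * L"
    using Dc Lc Omega_carrier by (rule transpose_sandwich_mult)
  then have "transpose_mat (D * L) * Omega M * (D * L) = transpose_mat L * Omega M * L"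
    by (simp add: symplectic_transposeD[OF D])
  then show ?thesis using L inv DLc unfolding sympl_int_lattice_def by simp
qed

section \<open>Comparison of the two codes under rotated noise\<close>

context
  fixes N M :: nat and \<sigma> :: real and S L Q T A D :: "real mat" and f f' :: "(nat \<Rightarrow> real) \<Rightarrow> nat \<Rightarrow> real"
  assumes \<sigma>: "\<sigma> > 0"
    and S: "symplectic (N+M) S" and T: "symplectic (N+M) T" and A: "symplectic N A" and D: "symplectic M D"
    and Q: "Q \<in> carrier_mat (2*(N+M)) (2*(N+M))" "transpose_mat Q * Q = 1\<^sub>m (2*(N+M))"
    and dec: "S = Q * T * four_block_mat A (0\<^sub>m (2*N) (2*M)) (0\<^sub>m (2*M) (2*N)) D"
    and L: "L \<in> carrier_mat (2*M) (2*M)"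
    and f: "estimator_measurable N M f"
    and f': "f' = (\<lambda>s i. \<Sum>j<2*N. A $$ (i,j) * f s j)"
begin

text \<open>The indices are swapped because S = Q T P gives T^-1 Q^T = P S^-1: the noise to be
  decoded by T is the transpose of Q applied to the original noise.\<close>

definition "rot = (\<lambda>i j. Q $$ (j,i))"

lemma Q_mult_transpose: "Q * transpose_mat Q = 1\<^sub>m (2*(N+M))"
  using Q by (intro mat_mult_left_right_inverse[of "transpose_mat Q"]) auto

lemma orthogonal_rot: "orthogonal_map (2*(N+M)) rot"
proof
  fix i j assume ij: "i < 2*(N+M)" "j < 2*(N+M)"
  have "(transpose_mat Q * Q) $$ (i,j) = (\<Sum>k<2*(N+M). rot i k * rot j k)"
    using Q ij by (subst mult_entry_sum[of _ "2*(N+M)" "2*(N+M)" _ "2*(N+M)"]) (auto simp: rot_def)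
  then show "(\<Sum>k<2*(N+M). rot i k * rot j k) = (if i = j then 1 else 0)" using Q ij by simp
  have "(Q * transpose_mat Q) $$ (i,j) = (\<Sum>k<2*(N+M). rot k i * rot k j)"
    using Q ij by (subst mult_entry_sum[of _ "2*(N+M)" "2*(N+M)" _ "2*(N+M)"]) (auto simp: rot_def)
  then show "(\<Sum>k<2*(N+M). rot k i * rot k j) = (if i = j then 1 else 0)" using Q_mult_transpose ij by simp
qed

text \<open>T^-1 Q^T = P S^-1 holds for matrices, hence pointwise in the noise; P acts separately on
  the data and ancilla parts.\<close>

lemma decoded_noise_rot:
  "decoded_noise N M T (lin (2*(N+M)) rot \<xi>) =
     (A *\<^sub>v vec (2*N) (\<lambda>i. decoded_noise N M S \<xi> $ i)) @\<^sub>v (D *\<^sub>v vec (2*M) (\<lambda>i. decoded_noise N M S \<xi> $ (2*N + i)))"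
proof -
  let ?K = "N + M" let ?d = "2*?K"
  let ?P = "four_block_mat A (0\<^sub>m (2*N) (2*M)) (0\<^sub>m (2*M) (2*N)) D"
  let ?v = "vec ?d \<xi>"
  note Sc = symplectic_carrier[OF S] and Tc = symplectic_carrier[OF T]
  note Ac = symplectic_carrier[OF A] and Dc = symplectic_carrier[OF D]
  have Pc: "?P \<in> carrier_mat ?d ?d" using four_block_carrier_mat[OF Ac Dc] by (simp add: algebra_simps)
  note Si = sinv_carrier[OF Sc] and Ti = sinv_carrier[OF Tc]
  have Qt: "transpose_mat Q \<in> carrier_mat ?d ?d" using Q by simp
  have eq: "sinv ?K T * transpose_mat Q = ?P * sinv ?K S"
  proof -
    have PS: "?P * sinv ?K S \<in> carrier_mat ?d ?d" and QT: "Q * T \<in> carrier_mat ?d ?d" 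
      and TQ: "sinv ?K T * transpose_mat Q \<in> carrier_mat ?d ?d"
      using Pc Si Q Tc Ti Qt by (auto intro!: mult_carrier_mat[of _ ?d ?d])
    have "Q * T * (?P * sinv ?K S) = Q * T * ?P * sinv ?K S"
      using QT Pc Si by (intro assoc_mult_mat[symmetric]) auto
    then have 1: "Q * T * (?P * sinv ?K S) = 1\<^sub>m ?d" using dec mult_sinv(1)[OF S] by simp
    have "sinv ?K T * transpose_mat Q * (Q * T) = sinv ?K T * (transpose_mat Q * (Q * T))"
      using Ti Qt QT by (intro assoc_mult_mat) auto
    also have "transpose_mat Q * (Q * T) = transpose_mat Q * Q * T"
      using Qt Q Tc by (intro assoc_mult_mat[symmetric]) auto
    also have "\<dots> = T" using Q Tc by simp
    finally have 2: "sinv ?K T * transpose_mat Q * (Q * T) = 1\<^sub>m ?d" using mult_sinv(2)[OF T] by simp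
    have "sinv ?K T * transpose_mat Q = sinv ?K T * transpose_mat Q * (Q * T * (?P * sinv ?K S))"
      using right_mult_one_mat[OF TQ] 1 by simp
    also have "\<dots> = sinv ?K T * transpose_mat Q * (Q * T) * (?P * sinv ?K S)"
      using TQ QT PS by (intro assoc_mult_mat[symmetric]) auto
    finally show ?thesis using 2 left_mult_one_mat[OF PS] by simp
  qed
  have v: "?v \<in> carrier_vec ?d" by simp
  have "vec ?d (lin ?d rot \<xi>) = transpose_mat Q *\<^sub>v ?v"
    using Q by (intro eq_vecI) (auto simp: lin_def rot_def scalar_prod_def lessThan_atLeast0)
  then have "decoded_noise N M T (lin ?d rot \<xi>) = sinv ?K T *\<^sub>v (transpose_mat Q *\<^sub>v ?v)"
    by (simp only: decoded_noise_def inv_mat_symplectic[OF T])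
  also have "\<dots> = ?P * sinv ?K S *\<^sub>v ?v" using Ti Qt v by (simp add: assoc_mult_mat_vec[symmetric] eq)
  also have "\<dots> = ?P *\<^sub>v decoded_noise N M S \<xi>"
    using Pc Si v by (simp only: decoded_noise_def inv_mat_symplectic[OF S] assoc_mult_mat_vec)
  also have "decoded_noise N M S \<xi> = vec (2*N) (\<lambda>i. decoded_noise N M S \<xi> $ i) @\<^sub>v vec (2*M) (\<lambda>i. decoded_noise N M S \<xi> $ (2*N + i))"
    using decoded_noise_carrier[OF S, of \<xi>] by (intro eq_vecI) (auto simp: algebra_simps)
  also have "?P *\<^sub>v \<dots> = (A *\<^sub>v vec (2*N) (\<lambda>i. decoded_noise N M S \<xi> $ i)) @\<^sub>v (D *\<^sub>v vec (2*M) (\<lambda>i. decoded_noise N M S \<xi> $ (2*N + i)))"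
    using Ac Dc by (subst four_block_mat_mult_vec[of _ "2*N" "2*N" _ "2*M" _ "2*M"]) auto
  finally show ?thesis .
qed

text \<open>The syndromes agree already before reduction by \<open>Rmod\<close>: (D L)^T Omega (D x)
  = L^T Omega x.\<close>

lemma syndrome_rot: "syndrome N M T (D * L) (lin (2*(N+M)) rot \<xi>) = syndrome N M S L \<xi>"
proof -
  let ?d = "2*M"
  define x where "x = vec ?d (\<lambda>i. decoded_noise N M S \<xi> $ (2*N + i))"
  have x: "x \<in> carrier_vec ?d" by (simp add: x_def)
  note Dc = symplectic_carrier[OF D] and Ac = symplectic_carrier[OF A]
  have xa: "vec ?d (\<lambda>i. decoded_noise N M T (lin (2*(N+M)) rot \<xi>) $ (2*N + i)) = D *\<^sub>v x"
    unfolding decoded_noise_rot x_def[symmetric] using Dc Ac by (intro eq_vecI) auto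
  have "transpose_mat (D * L) *\<^sub>v (Omega M *\<^sub>v (D *\<^sub>v x)) = (transpose_mat L * transpose_mat D) *\<^sub>v (Omega M *\<^sub>v (D *\<^sub>v x))"
    using Dc L by (simp add: transpose_mult)
  also have "\<dots> = transpose_mat L *\<^sub>v (transpose_mat D *\<^sub>v (Omega M *\<^sub>v (D *\<^sub>v x)))"
    using Dc L x by (intro assoc_mult_mat_vec[of _ ?d ?d _ ?d]) (auto intro!: mult_mat_vec_carrier)
  also have "transpose_mat D *\<^sub>v (Omega M *\<^sub>v (D *\<^sub>v x)) = transpose_mat D * Omega M * D *\<^sub>v x"
    using Dc x by (simp add: assoc_mult_mat_vec[of _ ?d ?d _ ?d] mult_mat_vec_carrier[of _ ?d ?d])
  also have "\<dots> = Omega M *\<^sub>v x" by (simp add: symplectic_transposeD[OF D])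
  finally have "transpose_mat (D * L) *\<^sub>v (Omega M *\<^sub>v (D *\<^sub>v x)) = transpose_mat L *\<^sub>v (Omega M *\<^sub>v x)" .
  then show ?thesis
    unfolding syndrome_def Let_def xa x_def[symmetric] by (simp only:)
qed

text \<open>Both estimators receive the same syndrome, so the new residual is A x_d - A f(s), with
  x_d and s those of the original code.\<close>

lemma residual_rot:
  assumes i: "i < 2*N"
  shows "residual N M T (D * L) f' (lin (2*(N+M)) rot \<xi>) i = (\<Sum>j<2*N. A $$ (i,j) * residual N M S L f \<xi> j)"
proof -
  note Ac = symplectic_carrier[OF A]
  have "decoded_noise N M T (lin (2*(N+M)) rot \<xi>) $ i = (A *\<^sub>v vec (2*N) (\<lambda>i. decoded_noise N M S \<xi> $ i)) $ i"
    unfolding decoded_noise_rot using i Ac by simp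
  also have "\<dots> = (\<Sum>j<2*N. A $$ (i,j) * decoded_noise N M S \<xi> $ j)"
    using i by (subst mult_vec_sum[OF Ac]) auto
  finally show ?thesis
    unfolding residual_def syndrome_rot f' by (simp add: right_diff_distrib sum_subtractf)
qed

lemma estimator_measurable_f': "estimator_measurable N M f'"
  using f unfolding estimator_measurable_def f'
  by (auto intro!: borel_measurable_sum borel_measurable_times)

lemma sets_noise [measurable_cong]: "sets (noise d \<sigma>) = sets (PiM {..<d} (\<lambda>_. borel))"
  by (simp add: noise_eq_density[OF \<sigma>] sets_leb)

lemma lin_noise: "lin d R \<in> noise d \<sigma> \<rightarrow>\<^sub>M noise d \<sigma>"
  by measurable

lemma noise_rot:
  fixes g :: "(nat \<Rightarrow> real) \<Rightarrow> real"
  assumes "g \<in> borel_measurable (PiM {..<2*(N+M)} (\<lambda>_. borel))"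
  shows "integrable (noise (2*(N+M)) \<sigma>) g \<longleftrightarrow> integrable (noise (2*(N+M)) \<sigma>) (\<lambda>\<xi>. g (lin (2*(N+M)) rot \<xi>))"
    and "integral\<^sup>L (noise (2*(N+M)) \<sigma>) g = integral\<^sup>L (noise (2*(N+M)) \<sigma>) (\<lambda>\<xi>. g (lin (2*(N+M)) rot \<xi>))"
proof -
  let ?n = "noise (2*(N+M)) \<sigma>"
  have g: "g \<in> borel_measurable ?n" using assms by (simp cong: measurable_cong_sets add: sets_noise)
  have d: "distr ?n ?n (lin (2*(N+M)) rot) = ?n" by (rule orthogonal_map.distr_noise_lin[OF orthogonal_rot \<sigma>])
  show "integrable ?n g \<longleftrightarrow> integrable ?n (\<lambda>\<xi>. g (lin (2*(N+M)) rot \<xi>))"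
    using integrable_distr_eq[OF lin_noise[of _ rot] g, unfolded d] .
  show "integral\<^sup>L ?n g = integral\<^sup>L ?n (\<lambda>\<xi>. g (lin (2*(N+M)) rot \<xi>))"
    using integral_distr[OF lin_noise[of _ rot] g, unfolded d] .
qed

context
  assumes fin: "finite_error N M \<sigma> S L f"
begin

text \<open>The finiteness hypothesis concerns squares only; mixed products are dominated by a^2 +
  b^2.\<close>

lemma residual_products_integrable:
  assumes "i < 2*N" "j < 2*N"
  shows "integrable (noise (2*(N+M)) \<sigma>) (\<lambda>\<xi>. residual N M S L f \<xi> i * residual N M S L f \<xi> j)"
proof (rule Bochner_Integration.integrable_bound)
  let ?n = "noise (2*(N+M)) \<sigma>" and ?r = "residual N M S L f"
  have "integrable ?n (\<lambda>\<xi>. (?r \<xi> i)\<^sup>2)" "integrable ?n (\<lambda>\<xi>. (?r \<xi> j)\<^sup>2)"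
    using fin assms by (auto simp: finite_error_def)
  then show "integrable ?n (\<lambda>\<xi>. (?r \<xi> i)\<^sup>2 + (?r \<xi> j)\<^sup>2)" by simp
  have "(\<lambda>\<xi>. ?r \<xi> i) \<in> borel_measurable ?n" "(\<lambda>\<xi>. ?r \<xi> j) \<in> borel_measurable ?n"
    using residual_measurable[OF S L f] assms by (simp_all cong: measurable_cong_sets add: sets_noise)
  then show "(\<lambda>\<xi>. ?r \<xi> i * ?r \<xi> j) \<in> borel_measurable ?n" by measurable
  show "AE \<xi> in ?n. norm (?r \<xi> i * ?r \<xi> j) \<le> norm ((?r \<xi> i)\<^sup>2 + (?r \<xi> j)\<^sup>2)"
  proof (rule AE_I2)
    fix \<xi>
    have "2 * (\<bar>a\<bar> * \<bar>b\<bar>) \<le> a\<^sup>2 + b\<^sup>2" for a b :: real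
      using sum_squares_bound[of "\<bar>a\<bar>" "\<bar>b\<bar>"] by (simp add: mult.assoc)
    from this[of "?r \<xi> i" "?r \<xi> j"] mult_nonneg_nonneg[OF abs_ge_zero[of "?r \<xi> i"] abs_ge_zero[of "?r \<xi> j"]]
    show "norm (?r \<xi> i * ?r \<xi> j) \<le> norm ((?r \<xi> i)\<^sup>2 + (?r \<xi> j)\<^sup>2)"
      unfolding real_norm_def abs_mult by linarith
  qed
qed

text \<open>Rotate the noise, expand the product of the residuals bilinearly, and integrate term by
  term, which is legitimate because every product is integrable. The case i = j yields finiteness of
  the new error, all pairs together the new covariance.\<close>

lemma transformed_products:
  assumes i: "i < 2*N" and j: "j < 2*N"
  defines "g \<equiv> \<lambda>\<xi>. residual N M T (D * L) f' \<xi> i * residual N M T (D * L) f' \<xi> j"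
  shows "integrable (noise (2*(N+M)) \<sigma>) g"
    and "integral\<^sup>L (noise (2*(N+M)) \<sigma>) g = (A * V_out N M \<sigma> S L f * transpose_mat A) $$ (i,j)"
proof -
  let ?n = "noise (2*(N+M)) \<sigma>" and ?r = "residual N M S L f"
  let ?V = "V_out N M \<sigma> S L f"
  note Ac = symplectic_carrier[OF A]
  have DL: "D * L \<in> carrier_mat (2*M) (2*M)" using symplectic_carrier[OF D] L by simp
  have g: "g \<in> borel_measurable (PiM {..<2*(N+M)} (\<lambda>_. borel))"
    unfolding g_def using residual_measurable[OF T DL estimator_measurable_f'] i j by simp
  have rot_eq: "g (lin (2*(N+M)) rot \<xi>) = (\<Sum>k<2*N. \<Sum>l<2*N. A $$ (i,k) * A $$ (j,l) * (?r \<xi> k * ?r \<xi> l))" for \<xi>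
    unfolding g_def residual_rot[OF i] residual_rot[OF j] by (simp add: sum_product mult_ac)
  have int: "integrable ?n (\<lambda>\<xi>. A $$ (i,k) * A $$ (j,l) * (?r \<xi> k * ?r \<xi> l))" if "k < 2*N" "l < 2*N" for k l
    using residual_products_integrable[OF that] by simp
  show "integrable ?n g"
    unfolding noise_rot(1)[OF g] rot_eq using int by (intro Bochner_Integration.integrable_sum) auto
  have "integral\<^sup>L ?n g = (\<Sum>k<2*N. \<Sum>l<2*N. A $$ (i,k) * A $$ (j,l) * integral\<^sup>L ?n (\<lambda>\<xi>. ?r \<xi> k * ?r \<xi> l))"
    unfolding noise_rot(2)[OF g] rot_eq using int
    by (subst Bochner_Integration.integral_sum, force intro!: Bochner_Integration.integrable_sum)
      (intro sum.cong refl, subst Bochner_Integration.integral_sum, auto)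
  also have "\<dots> = (\<Sum>k<2*N. \<Sum>l<2*N. A $$ (i,k) * ?V $$ (k,l) * A $$ (j,l))"
    by (intro sum.cong refl) (auto simp: V_out_def)
  also have "\<dots> = (\<Sum>l<2*N. \<Sum>k<2*N. A $$ (i,k) * ?V $$ (k,l) * A $$ (j,l))" by (rule sum.swap)
  also have "\<dots> = (A * ?V * transpose_mat A) $$ (i,j)"
  proof -
    have Vc: "?V \<in> carrier_mat (2*N) (2*N)" by (simp add: V_out_def)
    have "(A * ?V * transpose_mat A) $$ (i,j) = (\<Sum>l<2*N. (A * ?V) $$ (i,l) * transpose_mat A $$ (l,j))"
      using Ac Vc i j by (intro mult_entry_sum) auto
    also have "\<dots> = (\<Sum>l<2*N. (\<Sum>k<2*N. A $$ (i,k) * ?V $$ (k,l)) * A $$ (j,l))"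
      using Ac Vc i j by (intro sum.cong refl) (simp add: mult_entry_sum[OF Ac Vc i] del: index_mult_mat)
    finally show ?thesis by (simp add: sum_distrib_right)
  qed
  finally show "integral\<^sup>L ?n g = (A * ?V * transpose_mat A) $$ (i,j)" .
qed

lemma finite_error_rot: "finite_error N M \<sigma> T (D * L) f'"
  unfolding finite_error_def using transformed_products(1) by (simp add: power2_eq_square)

lemma gm_error_rot: "gm_error N M \<sigma> T (D * L) f' = gm_error N M \<sigma> S L f"
proof -
  let ?V = "V_out N M \<sigma> S L f"
  note Ac = symplectic_carrier[OF A]
  have Vc: "?V \<in> carrier_mat (2*N) (2*N)" by (simp add: V_out_def)
  have "V_out N M \<sigma> T (D * L) f' = A * ?V * transpose_mat A"
  proof (rule eq_matI)
    fix i j assume "i < dim_row (A * ?V * transpose_mat A)" "j < dim_col (A * ?V * transpose_mat A)"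
    then have ij: "i < 2*N" "j < 2*N" using Ac by auto
    then have "V_out N M \<sigma> T (D * L) f' $$ (i,j) = integral\<^sup>L (noise (2*(N+M)) \<sigma>)
        (\<lambda>\<xi>. residual N M T (D * L) f' \<xi> i * residual N M T (D * L) f' \<xi> j)"
      by (simp add: V_out_def)
    also have "\<dots> = (A * ?V * transpose_mat A) $$ (i,j)" by (rule transformed_products(2)[OF ij])
    finally show "V_out N M \<sigma> T (D * L) f' $$ (i,j) = (A * ?V * transpose_mat A) $$ (i,j)" .
  qed (use Ac in \<open>auto simp: V_out_def\<close>)
  also have "det \<dots> = det A * det ?V * det A"
    using Ac Vc by (simp add: det_mult[of _ "2*N"] det_transpose)
  finally have "det (V_out N M \<sigma> T (D * L) f') = det ?V"
    using det_symplectic_square[OF A] by (simp add: power2_eq_square algebra_simps)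
  then show ?thesis by (simp add: gm_error_def)
qed

end

end

theorem theorem1:
  fixes N M :: nat and \<sigma> :: real and S L :: "real mat"
    and f :: "(nat \<Rightarrow> real) \<Rightarrow> (nat \<Rightarrow> real)"
  assumes "1 \<le> N" and "N \<le> M" and "\<sigma> > 0"
    and "gkp_code N M S L f"
    and "finite_error N M \<sigma> S L f"
  shows "\<exists>G \<Lambda> f'. (\<forall>i<N. 1 \<le> G i) \<and> symplectic M \<Lambda> \<and>
           gkp_code N M (tms_enc N M G) (\<Lambda> * L) f' \<and>
           finite_error N M \<sigma> (tms_enc N M G) (\<Lambda> * L) f' \<and>
           gm_error N M \<sigma> (tms_enc N M G) (\<Lambda> * L) f' = gm_error N M \<sigma> S L f"
proof -
  have S: "symplectic (N+M) S" and L: "sympl_int_lattice M L" and f: "estimator_measurable N M f"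
    using assms(4) by (auto simp: gkp_code_def)
  have Lc: "L \<in> carrier_mat (2*M) (2*M)" using L by (simp add: sympl_int_lattice_def)
  obtain G Q A D where G: "\<forall>i<N. 1 \<le> G i" and Q: "Q \<in> carrier_mat (2*(N+M)) (2*(N+M))"
    "transpose_mat Q * Q = 1\<^sub>m (2*(N+M))" and A: "symplectic N A" and D: "symplectic M D"
    and dec: "S = Q * tms_enc N M G * four_block_mat A (0\<^sub>m (2*N) (2*M)) (0\<^sub>m (2*M) (2*N)) D"
    by (rule symplectic_tms_decomposition[OF assms(1,2) S])
  have T: "symplectic (N+M) (tms_enc N M G)" by (rule symplectic_tms_enc[OF assms(1,2) G])
  \<comment> \<open>The factors of S supply the witnesses: D transforms the lattice, and A, which
    multiplies the decoded data noise, multiplies the estimate as well.\<close>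
  let ?f = "\<lambda>s i. \<Sum>j<2*N. A $$ (i,j) * f s j"
  note ctx = assms(3) S T A D Q dec Lc f refl[of ?f]
  have "gkp_code N M (tms_enc N M G) (D * L) ?f"
    unfolding gkp_code_def
    using T sympl_int_lattice_mult[OF D L] estimator_measurable_f'[OF ctx] by blast
  then show ?thesis
    using G D finite_error_rot[OF ctx assms(5)] gm_error_rot[OF ctx assms(5)] by blast
qed

end
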